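(* Let $G$ be a graph with $\mathrm{Mad}(G) < \frac{26}{11}$. Then there exists a vertex partition $V(G)=I\,\dot{\cup}\,F$ such that $F$ induces a forest in $G$ and $I$ is a 2-independent set in $G$.
   Context: Graphs are finite and simple. The maximum average degree is $\mathrm{Mad}(G)=\max\{2|E(H)|/|V(H)| : H\subseteq G\}$, the maximum being over subgraphs $H$ with at least one vertex. $d_G(x,y)$ is the distance in $G$ between $x$ and $y$ (the number of edges of a shortest path; infinite if there is none). A set $I\subseteq V(G)$ is 2-independent if $d_G(x,y)>2$ for all distinct $x,y\in I$. $\dot\cup$ denotes disjoint union; parts of the partition may be empty. *)

theory Defs
  imports "Graph_Theory.Graph_Theory"
begin

text \<open>
  Finite simple graphs are the finite, loopless, symmetric digraphs without parallel arcs of the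
  locale \<^locale>\<open>graph\<close>; an undirected edge \<open>{u, v}\<close> is represented by the two arcs between
  \<open>u\<close> and \<open>v\<close>.
\<close>

definition edges :: "('a, 'b) pre_digraph \<Rightarrow> 'a set set" where
  "edges G = {{u, v} | u v. u \<rightarrow>\<^bsub>G\<^esub> v}"

text \<open>
  \<^const>\<open>subgraph\<close> is the notion for digraphs, so symmetry of the subgraph is imposed by
  \<^term>\<open>graph H\<close>. The value is unspecified if \<open>G\<close> has no vertices.
\<close>

definition mad :: "('a, 'b) pre_digraph \<Rightarrow> real" where
  "mad G = Max {2 * real (card (edges H)) / real (card (verts H)) | H.
     graph H \<and> subgraph H G \<and> verts H \<noteq> {}}"

lemma (in graph) finite_subgraphs: "finite {H. subgraph H G}"
proof -
  have "{H. subgraph H G} \<subseteq> (\<lambda>(V, A). \<lparr>verts = V, arcs = A, tail = tail G, head = head G\<rparr>) `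
    (Pow (verts G) \<times> Pow (arcs G))"
  proof
    fix H assume "H \<in> {H. subgraph H G}"
    then have "verts H \<subseteq> verts G" "arcs H \<subseteq> arcs G"
      "H = \<lparr>verts = verts H, arcs = arcs H, tail = tail G, head = head G\<rparr>"
      by (auto simp: subgraph_def compatible_def)
    then show "H \<in> (\<lambda>(V, A). \<lparr>verts = V, arcs = A, tail = tail G, head = head G\<rparr>) `
      (Pow (verts G) \<times> Pow (arcs G))"
      by (intro image_eqI[where x = "(verts H, arcs H)"]) auto
  qed
  then show ?thesis
    by (rule finite_subset) simp
qed

text \<open>
  In a symmetric digraph, \<^const>\<open>pre_digraph.cycle\<close> also holds of the closed walk \<open>u, v, u\<close> along
  a single edge, so that \<^const>\<open>forest\<close> fails as soon as there is an edge. The cycles of a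
  simple undirected graph are those of length at least 3.
\<close>

definition undirected_forest :: "('a, 'b) pre_digraph \<Rightarrow> bool" where
  "undirected_forest G \<longleftrightarrow> \<not> (\<exists>p. pre_digraph.cycle G p \<and> length p \<ge> 3)"

text \<open>\<^const>\<open>wf_digraph.\<mu>\<close> is the infimum of the costs of walks; here every arc costs 1.\<close>

definition graph_dist :: "('a, 'b) pre_digraph \<Rightarrow> 'a \<Rightarrow> 'a \<Rightarrow> ereal" where
  "graph_dist G x y = wf_digraph.\<mu> G (\<lambda>_. 1) x y"

definition two_independent :: "('a, 'b) pre_digraph \<Rightarrow> 'a set \<Rightarrow> bool" where
  "two_independent G I \<longleftrightarrow>
     I \<subseteq> verts G \<and> (\<forall>x\<in>I. \<forall>y\<in>I. x \<noteq> y \<longrightarrow> graph_dist G x y > 2)"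

end

theory Submission
  imports Defs
begin

text \<open>
  The theorem is proved by induction in a stronger form, in which some vertices (the set \<open>A\<close>) are
  precoloured: they have to belong to the forest and must not have neighbours in the independent
  set. Ordinary vertices have weight 13, precoloured ones weight 5 and edges weight -11, and every
  nonempty vertex set is assumed to have positive weight (its potential). In a minimal
  counterexample, a proper vertex set of potential at most 3 could be partitioned first and then
  contracted to a precoloured vertex, so such sets do not exist. This gap, together with the
  submodularity of the potential, excludes the one configuration that is not locally reducible:
  two adjacent vertices of degree 3 from which four paths with two inner vertices of degree 2
  emanate. Discharging with initial charge 11 deg - 26 (respectively 11 deg - 10 on \<open>A\<close>) then
  contradicts the positivity of the potential.
\<close>

subsection \<open>Potential and forests\<close>

text \<open>The weights 13 and 11 restate the bound 26/11: a nonempty set of n vertices that spans m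
  edges satisfies 11 m < 13 n. The weight 5 is pinned from two sides. A precoloured vertex of degree
  1 starts the discharging with 11 - 2 * 5 = 1, exactly what a deficient neighbour may claim from
  it, so a larger weight would not do. Contraction trades an edge of weight 11 for a precoloured
  vertex, which lowers the potential by 8; the difference 3 is the largest potential that a
  contracted set may have, so a smaller weight would narrow the gap. The gap has no slack either:
  three sets of potential at most 7 that overlap twice must have a union of potential below 14, and
  7 + 7 + 7 - 4 - 4 = 13. The obstacle in the excluded configuration is that a path between two of
  its outer ends may have to join the forest and can close a cycle through the rest of the graph.
  The smaller graph therefore keeps a path between these ends; where this destroys sparsity, the
  union of the dense sets gives the contradiction.\<close>

definition nbh :: "('a \<Rightarrow> 'a \<Rightarrow> bool) \<Rightarrow> 'a set \<Rightarrow> 'a \<Rightarrow> 'a set" where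
  "nbh R S u = {v \<in> S. R u v}"

definition deg :: "('a \<Rightarrow> 'a \<Rightarrow> bool) \<Rightarrow> 'a set \<Rightarrow> 'a \<Rightarrow> nat" where
  "deg R S u = card (nbh R S u)"

definition edges_in :: "('a \<Rightarrow> 'a \<Rightarrow> bool) \<Rightarrow> 'a set \<Rightarrow> 'a set set" where
  "edges_in R S = {{u, v} | u v. u \<in> S \<and> v \<in> S \<and> R u v}"

definition potential :: "('a \<Rightarrow> 'a \<Rightarrow> bool) \<Rightarrow> 'a set \<Rightarrow> 'a set \<Rightarrow> int" where
  "potential R A S = 13 * int (card (S - A)) + 5 * int (card (S \<inter> A)) - 11 * int (card (edges_in R S))"

definition sparse :: "('a \<Rightarrow> 'a \<Rightarrow> bool) \<Rightarrow> 'a set \<Rightarrow> 'a set \<Rightarrow> bool" where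
  "sparse R A V \<longleftrightarrow> (\<forall>S \<subseteq> V. S \<noteq> {} \<longrightarrow> potential R A S \<ge> 1)"

definition few :: "('a \<Rightarrow> 'a \<Rightarrow> bool) \<Rightarrow> 'a set \<Rightarrow> 'a \<Rightarrow> bool" where
  "few R W w \<longleftrightarrow> (\<forall>x \<in> W. \<forall>y \<in> W. R w x \<longrightarrow> R w y \<longrightarrow> x = y)"

text \<open>On finite sets, being 1-degenerate is the same as being acyclic.\<close>

definition acyclic_on :: "('a \<Rightarrow> 'a \<Rightarrow> bool) \<Rightarrow> 'a set \<Rightarrow> bool" where
  "acyclic_on R F \<longleftrightarrow> (\<forall>W \<subseteq> F. W \<noteq> {} \<longrightarrow> (\<exists>w \<in> W. few R W w))"

text \<open>
  The set \<open>A\<close> consists of vertices that are precoloured as belonging to the forest and as having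
  a neighbour in the independent set outside of the graph.
\<close>

definition good :: "('a \<Rightarrow> 'a \<Rightarrow> bool) \<Rightarrow> 'a set \<Rightarrow> 'a set \<Rightarrow> 'a set \<Rightarrow> bool" where
  "good R A V I \<longleftrightarrow> I \<subseteq> V - A \<and>
     (\<forall>k \<in> V. \<forall>i \<in> I. R k i \<longrightarrow> k \<notin> A \<and> k \<notin> I \<and> (\<forall>j \<in> I. R k j \<longrightarrow> j = i)) \<and>
     acyclic_on R (V - I)"

text \<open>An order in which vertices join the forest \<open>F\<close> one by one, each as a leaf
  or as an isolated vertex. Vertices already present are passed over, so the list may overlap
  \<open>F\<close> or repeat itself.\<close>

primrec attachable :: "('a \<Rightarrow> 'a \<Rightarrow> bool) \<Rightarrow> 'a set \<Rightarrow> 'a list \<Rightarrow> bool" where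
  "attachable R F [] \<longleftrightarrow> True"
| "attachable R F (x # xs) \<longleftrightarrow> (x \<notin> F \<longrightarrow> few R F x) \<and> attachable R (insert x F) xs"

lemma fewI: "(\<And>x y. x \<in> W \<Longrightarrow> y \<in> W \<Longrightarrow> R w x \<Longrightarrow> R w y \<Longrightarrow> x = y) \<Longrightarrow> few R W w"
  by (auto simp: few_def)

lemma fewD: "few R W w \<Longrightarrow> x \<in> W \<Longrightarrow> y \<in> W \<Longrightarrow> R w x \<Longrightarrow> R w y \<Longrightarrow> x = y"
  by (auto simp: few_def)

lemma few_iff: "few R W w \<longleftrightarrow> (\<forall>x. R w x \<longrightarrow> x \<in> W \<longrightarrow> (\<forall>y. R w y \<longrightarrow> y \<in> W \<longrightarrow> x = y))"
  by (auto simp: few_def)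

lemma edges_in_mono: "S \<subseteq> T \<Longrightarrow> edges_in R S \<subseteq> edges_in R T"
  by (auto simp: edges_in_def)

lemma finite_edges_in [simp]: "finite S \<Longrightarrow> finite (edges_in R S)"
  by (rule finite_subset[of _ "Pow S"]) (auto simp: edges_in_def)

lemma finite_nbh [simp]: "finite S \<Longrightarrow> finite (nbh R S u)"
  by (simp add: nbh_def)

lemma edges_in_empty [simp]: "edges_in R {} = {}"
  by (simp add: edges_in_def)

lemma potential_empty [simp]: "potential R A {} = 0"
  by (simp add: potential_def)

lemma sparse_mono: "sparse R A V \<Longrightarrow> V' \<subseteq> V \<Longrightarrow> sparse R A V'"
  by (auto simp: sparse_def)

lemma potential_cong: "(\<And>u v. u \<in> S \<Longrightarrow> v \<in> S \<Longrightarrow> R u v \<longleftrightarrow> R' u v) \<Longrightarrow> S \<inter> A = S \<inter> A' \<Longrightarrow>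
  potential R A S = potential R' A' S"
proof -
  assume *: "\<And>u v. u \<in> S \<Longrightarrow> v \<in> S \<Longrightarrow> R u v \<longleftrightarrow> R' u v" and A: "S \<inter> A = S \<inter> A'"
  have "edges_in R S = edges_in R' S"
    unfolding edges_in_def using * by blast
  moreover have "S - A = S - A'" using A by blast
  ultimately show ?thesis using A by (simp add: potential_def)
qed

locale sgraph =
  fixes R :: "'a \<Rightarrow> 'a \<Rightarrow> bool"
  assumes sym: "R u v \<Longrightarrow> R v u"
    and irrefl [simp]: "\<not> R u u"
begin

lemma sym_iff: "R u v \<longleftrightarrow> R v u"
  using sym by blast

lemma acyclic_on_insert:
  assumes "acyclic_on R F" and "v \<notin> F \<Longrightarrow> few R F v"
  shows "acyclic_on R (insert v F)"
proof (cases "v \<in> F")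
  case False
  then have few: "few R F v" using assms by blast
  show ?thesis unfolding acyclic_on_def
  proof (intro allI impI)
    fix W assume W: "W \<subseteq> insert v F" "W \<noteq> {}"
    show "\<exists>w\<in>W. few R W w"
    proof (cases "v \<in> W")
      case True
      have "few R W v"
      proof (rule fewI)
        fix x y assume xy: "x \<in> W" "y \<in> W" "R v x" "R v y"
        then have "x \<in> F" "y \<in> F" using W(1) irrefl by blast+
        then show "x = y" using few xy by (blast dest: fewD)
      qed
      then show ?thesis using True by blast
    next
      case False
      then show ?thesis using W assms(1) unfolding acyclic_on_def by blast
    qed
  qed
qed (use assms in \<open>auto simp: insert_absorb\<close>)

lemma acyclic_on_attachable:
  "acyclic_on R F \<Longrightarrow> attachable R F xs \<Longrightarrow> acyclic_on R (F \<union> set xs)"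
proof (induction xs arbitrary: F)
  case (Cons x xs)
  then have "acyclic_on R (insert x F)" by (intro acyclic_on_insert) auto
  with Cons have "acyclic_on R (insert x F \<union> set xs)" by (simp del: Un_insert_left)
  then show ?case by simp
qed simp

text \<open>Used when two forests are glued along one edge at \<open>s\<close>: a leaf of one side
  that avoids \<open>s\<close> is a leaf of the whole.\<close>

lemma acyclic_on_two_leaves:
  assumes "acyclic_on R F" "finite W" "W \<subseteq> F" "s \<in> W"
  shows "\<exists>w\<in>W. few R W w \<and> (w \<noteq> s \<or> W = {s})"
  using assms(2-4)
proof (induction "card W" arbitrary: W s rule: less_induct)
  case less
  obtain l where l: "l \<in> W" "few R W l"
    using assms(1) less.prems unfolding acyclic_on_def by blast
  show ?case
  proof (cases "l = s \<and> W \<noteq> {s}")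
    case False
    then show ?thesis using l by blast
  next
    case True
    define W' where "W' = W - {s}"
    have W': "W' \<noteq> {}" "finite W'" "W' \<subseteq> F" "card W' < card W"
      using True less.prems by (auto simp: W'_def simp del: card_Diff_insert intro!: psubset_card_mono)
    \<comment> \<open>Once \<open>s\<close> is removed, a leaf other than its only neighbour
      \<open>r\<close> stays a leaf when \<open>s\<close> returns. If \<open>s\<close> is isolated,
      any \<open>r\<close> serves.\<close>
    obtain r where r: "r \<in> W'" "\<And>x. x \<in> W' \<Longrightarrow> R s x \<Longrightarrow> x = r"
    proof (cases "\<exists>r\<in>W'. R s r")
      case T: True
      then obtain r where "r \<in> W'" "R s r" by blast
      moreover from this have "x = r" if "x \<in> W'" "R s x" for x
        using that True l(2) by (auto simp: W'_def dest: fewD)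
      ultimately show ?thesis using that by blast
    next
      case False
      then show ?thesis using that W' by blast
    qed
    obtain w where w: "w \<in> W'" "few R W' w" "w \<noteq> r \<or> W' = {r}"
      using less.hyps[OF W'(4,2,3) r(1)] by blast
    have "few R W w"
    proof (cases "w = r")
      case False
      then have "\<not> R w s" using r w(1) sym by blast
      then show ?thesis using w(2) by (auto simp: few_def W'_def)
    next
      case True
      then have "W' = {w}" using w by blast
      then have "W = {s, w}" using less.prems by (auto simp: W'_def)
      then show ?thesis by (auto simp: few_def)
    qed
    then show ?thesis using w by (auto simp: W'_def)
  qed
qed

section \<open>Edge counts and submodularity of the potential\<close>

lemma edges_in_insert:
  "edges_in R (insert u S) = edges_in R S \<union> (\<lambda>v. {u, v}) ` nbh R S u"
  by (auto simp: edges_in_def nbh_def insert_commute sym_iff)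

lemma card_edges_in_insert:
  assumes "finite S" "u \<notin> S"
  shows "card (edges_in R (insert u S)) = card (edges_in R S) + deg R S u"
proof -
  have "edges_in R S \<inter> (\<lambda>v. {u, v}) ` nbh R S u = {}"
    using assms by (auto simp: edges_in_def doubleton_eq_iff)
  moreover have "card ((\<lambda>v. {u, v}) ` nbh R S u) = deg R S u"
    unfolding deg_def by (rule card_image) (auto simp: inj_on_def doubleton_eq_iff)
  ultimately show ?thesis
    unfolding edges_in_insert using assms by (subst card_Un_disjoint) auto
qed

lemma deg_insert:
  assumes "finite S" "u \<notin> S"
  shows "deg R (insert u S) k = deg R S k + of_bool (R k u)"
proof -
  have "nbh R (insert u S) k = (if R k u then insert u (nbh R S k) else nbh R S k)"
    by (auto simp: nbh_def)
  moreover have "u \<notin> nbh R S k" using assms by (auto simp: nbh_def)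
  ultimately show ?thesis using assms by (simp add: deg_def)
qed

lemma sum_deg:
  assumes "finite S"
  shows "(\<Sum>u\<in>S. deg R S u) = 2 * card (edges_in R S)"
  using assms
proof induction
  case (insert a S)
  have "(\<Sum>u\<in>S. of_bool (R u a)) = deg R S a"
    using insert by (simp add: deg_def nbh_def Int_def sym_iff)
  with insert show ?case
    by (simp add: card_edges_in_insert deg_insert sum.distrib)
qed simp

lemma card_edges_in_Un_disjoint:
  assumes "finite S" "finite T" "S \<inter> T = {}"
  shows "card (edges_in R (T \<union> S)) = card (edges_in R T) + card (edges_in R S) + (\<Sum>u\<in>T. deg R S u)"
  using assms(2,3)
proof induction
  case (insert a T)
  have "deg R (T \<union> S) a = deg R T a + deg R S a"
    unfolding deg_def using insert assms(1)
    by (subst card_Un_disjoint[symmetric]) (auto simp: nbh_def intro: arg_cong[where f = card])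
  with insert assms(1) show ?case
    by (simp add: card_edges_in_insert)
qed simp

lemma potential_insert:
  assumes "finite S" "u \<notin> S"
  shows "potential R A (insert u S) = potential R A S + (if u \<in> A then 5 else 13) - 11 * int (deg R S u)"
proof -
  have "insert u S - A = (if u \<in> A then S - A else insert u (S - A))"
       "insert u S \<inter> A = (if u \<in> A then insert u (S \<inter> A) else S \<inter> A)"
    by auto
  then show ?thesis using assms by (simp add: potential_def card_edges_in_insert)
qed

lemma potential_Un_disjoint:
  assumes "finite S" "finite T" "S \<inter> T = {}"
  shows "potential R A (T \<union> S) = potential R A T + potential R A S - 11 * int (\<Sum>u\<in>T. deg R S u)"
proof -
  have "card (T \<union> S - A) = card (T - A) + card (S - A)" "card ((T \<union> S) \<inter> A) = card (T \<inter> A) + card (S \<inter> A)"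
    using assms by (subst card_Un_disjoint[symmetric]; auto intro: arg_cong[where f = card])+
  then show ?thesis using assms by (simp add: potential_def card_edges_in_Un_disjoint)
qed

text \<open>The vertex terms are modular. Edges inside \<open>S\<close> and edges inside
  \<open>T\<close> share exactly the edges inside \<open>S \<inter> T\<close>, while an edge between
  \<open>S - T\<close> and \<open>T - S\<close> counts in the union only.\<close>

lemma potential_submodular:
  assumes "finite S" "finite T"
  shows "potential R A (S \<union> T) + potential R A (S \<inter> T) \<le> potential R A S + potential R A T"
proof -
  have "edges_in R S \<inter> edges_in R T = edges_in R (S \<inter> T)"
    by (intro equalityI subsetI; fastforce simp: edges_in_def doubleton_eq_iff)
  moreover have "card (edges_in R S \<union> edges_in R T) \<le> card (edges_in R (S \<union> T))"
    using assms by (intro card_mono finite_edges_in Un_least edges_in_mono) auto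
  ultimately have "card (edges_in R S) + card (edges_in R T) \<le> card (edges_in R (S \<union> T)) + card (edges_in R (S \<inter> T))"
    using card_Un_Int[of "edges_in R S" "edges_in R T"] assms by simp
  moreover have "card (S - A) + card (T - A) = card (S \<union> T - A) + card (S \<inter> T - A)"
  proof -
    have "(S - A) \<union> (T - A) = S \<union> T - A" "(S - A) \<inter> (T - A) = S \<inter> T - A" by blast+
    then show ?thesis using card_Un_Int[of "S - A" "T - A"] assms by simp
  qed
  moreover have "card (S \<inter> A) + card (T \<inter> A) = card ((S \<union> T) \<inter> A) + card ((S \<inter> T) \<inter> A)"
  proof -
    have "(S \<inter> A) \<union> (T \<inter> A) = (S \<union> T) \<inter> A" "(S \<inter> A) \<inter> (T \<inter> A) = (S \<inter> T) \<inter> A" by blast+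
    then show ?thesis using card_Un_Int[of "S \<inter> A" "T \<inter> A"] assms by simp
  qed
  ultimately show ?thesis unfolding potential_def by linarith
qed

lemma potential_insert_le:
  assumes "finite S" "u \<notin> S" "u \<notin> A" "K \<subseteq> S" "\<forall>k\<in>K. R u k"
  shows "potential R A (insert u S) \<le> potential R A S + 13 - 11 * int (card K)"
proof -
  have "card K \<le> deg R S u"
    unfolding deg_def using assms by (intro card_mono) (auto simp: nbh_def)
  then show ?thesis using assms(3) potential_insert[OF assms(1,2), of A] by simp
qed

end

subsection \<open>The gap lemma\<close>

text \<open>\<open>smaller_good\<close> ranges over all relations and all precoloured sets because
  the reductions contract sets, add an edge and precolour vertices. Contraction reuses an element of
  the contracted set, so the vertex type never changes.\<close>

locale minimal_counterexample = sgraph R for R :: "'a \<Rightarrow> 'a \<Rightarrow> bool" +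
  fixes A V :: "'a set"
  assumes finite_V [simp]: "finite V"
    and edge_in_V: "R u v \<Longrightarrow> u \<in> V"
    and sparse: "sparse R A V"
    and smaller_good: "\<And>(R' :: 'a \<Rightarrow> 'a \<Rightarrow> bool) A' V'. card V' < card V \<Longrightarrow> finite V' \<Longrightarrow> sgraph R' \<Longrightarrow> sparse R' A' V' \<Longrightarrow>
      \<exists>I. good R' A' V' I"
    and not_good: "\<not> good R A V I"
begin

lemma edge_in_V': "R u v \<Longrightarrow> v \<in> V"
  using edge_in_V sym by blast

lemma finite_subset_V [simp]: "S \<subseteq> V \<Longrightarrow> finite S"
  using finite_V finite_subset by blast

lemma potential_ge_1: "S \<subseteq> V \<Longrightarrow> S \<noteq> {} \<Longrightarrow> potential R A S \<ge> 1"
  using sparse by (auto simp: sparse_def)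

text \<open>
  A set \<open>S\<close> of smaller potential is partitioned first. Contracting \<open>S\<close> to a single precoloured vertex
  \<open>p\<close> and precolouring the neighbours of its independent set keeps the graph sparse.
\<close>

lemma potential_proper_subset:
  assumes S: "S \<subset> V" "S \<noteq> {}"
  shows "potential R A S \<ge> 4"
proof (rule ccontr)
  assume "\<not> ?thesis"
  then have pot_S: "potential R A S \<le> 3" by simp
  have fin_S: "finite S" using S by auto
  obtain p where p: "p \<in> S" using S by blast
  have "S \<noteq> {p}"
    using pot_S potential_insert[of "{}" p A] by (auto simp: deg_def nbh_def split: if_splits)
  then have card_S: "card S \<ge> 2"
  proof -
    have "{p} \<subset> S" using p \<open>S \<noteq> {p}\<close> by blast
    then show ?thesis using psubset_card_mono[OF fin_S, of "{p}"] by simp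
  qed
  have "card S < card V" using S by (simp add: psubset_card_mono)
  then obtain I where I: "good R A S I"
    using smaller_good[OF _ fin_S sgraph_axioms] sparse_mono[OF sparse, of S] S by blast
  \<comment> \<open>Adding \<open>u\<close> to \<open>S\<close> must leave potential at least 1. So
    the edges from \<open>u\<close> to \<open>S\<close> weigh at most 15 if \<open>u\<close> is
    ordinary, which permits one edge, and at most 7 if \<open>u\<close> is precoloured, which
    permits none.\<close>
  have deg_le: "11 * int (deg R S u) \<le> (if u \<in> A then 5 else 13) + 2" if "u \<in> V - S" for u
  proof -
    have "potential R A (insert u S) \<ge> 1"
      using that S by (intro potential_ge_1) auto
    then show ?thesis using pot_S potential_insert[OF fin_S, of u A] that by simp
  qed
  have unique: "x = y" if "u \<in> V - S" "x \<in> S" "y \<in> S" "R u x" "R u y" for u x y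
  proof (rule ccontr)
    assume "x \<noteq> y"
    moreover have "card {x, y} \<le> deg R S u"
      unfolding deg_def using that fin_S by (intro card_mono) (auto simp: nbh_def)
    ultimately show False using deg_le[OF that(1)] by (simp split: if_splits)
  qed
  have A_outside: "\<not> R u x" if "u \<in> V - S" "u \<in> A" "x \<in> S" for u x
  proof
    assume "R u x"
    then have "deg R S u \<noteq> 0" using that fin_S by (auto simp: deg_def nbh_def)
    then show False using deg_le[OF that(1)] that by (simp split: if_splits)
  qed
  \<comment> \<open>Vertices of \<open>B\<close> see the independent set of \<open>S\<close>,
    vertices of \<open>C\<close> its forest. Precolouring \<open>B\<close> and \<open>p\<close>,
    whose neighbours are \<open>C\<close>, keeps both sets out of the second independent set, so no
    vertex of \<open>S\<close> gets a neighbour there.\<close>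
  define B where "B = {u \<in> V - S. \<exists>s\<in>I. R u s}"
  define C where "C = {u \<in> V - S. \<exists>s\<in>S - I. R u s}"
  define A' where "A' = (A - S) \<union> {p} \<union> B"
  define V' where "V' = (V - S) \<union> {p}"
  define R' where "R' u k \<longleftrightarrow> (u \<notin> S \<and> k \<notin> S \<and> R u k) \<or> (u = p \<and> k \<in> C) \<or> (k = p \<and> u \<in> C)" for u k
  have I_S: "I \<subseteq> S - A" using I by (auto simp: good_def)
  have BS: "B \<subseteq> V - S" and CS: "C \<subseteq> V - S" by (auto simp: B_def C_def)
  have deg_S: "deg R S u = of_bool (u \<in> B) + of_bool (u \<in> C)" if "u \<in> V - S" for u
  proof (cases "\<exists>s\<in>S. R u s")
    case True
    then obtain s where s: "s \<in> S" "R u s" by blast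
    then have only_s: "t = s" if "t \<in> S" "R u t" for t
      using unique[OF \<open>u \<in> V - S\<close>] that by blast
    then have "nbh R S u = {s}" using s unfolding nbh_def by blast
    moreover have "u \<in> B \<longleftrightarrow> s \<in> I" "u \<in> C \<longleftrightarrow> s \<notin> I"
      using s that only_s I_S unfolding B_def C_def by blast+
    ultimately show ?thesis by (simp add: deg_def)
  next
    case False
    then have "nbh R S u = {}" "u \<notin> B" "u \<notin> C" using I_S by (auto simp: nbh_def B_def C_def)
    then show ?thesis by (simp add: deg_def)
  qed
  interpret R': sgraph R'
    using p CS by unfold_locales (auto simp: R'_def sym_iff)
  have "sparse R' A' V'"
    unfolding sparse_def
  proof (intro allI impI)
    fix T assume T: "T \<subseteq> V'" "T \<noteq> {}"
    define T0 where "T0 = T - {p}"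
    have "T0 \<subseteq> V - S" using T by (auto simp: T0_def V'_def)
    moreover from this have "finite T0" using finite_subset_V[of T0] by blast
    ultimately have T0: "T0 \<subseteq> V - S" "finite T0" by blast+
    have "(\<Sum>u\<in>T0. deg R S u) = card (T0 \<inter> B) + card (T0 \<inter> C)"
    proof -
      have "(\<Sum>u\<in>T0. deg R S u) = (\<Sum>u\<in>T0. of_bool (u \<in> B) + of_bool (u \<in> C))"
        using T0 deg_S by (intro sum.cong) auto
      also have "\<dots> = card (T0 \<inter> B) + card (T0 \<inter> C)"
        using T0 by (simp add: sum.distrib)
      finally show ?thesis .
    qed
    moreover have "potential R A (T0 \<union> S) \<ge> 1"
      using T0 S by (intro potential_ge_1) auto
    moreover have "potential R A (T0 \<union> S) = potential R A T0 + potential R A S - 11 * int (\<Sum>u\<in>T0. deg R S u)"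
      using T0 fin_S by (intro potential_Un_disjoint) auto
    ultimately have T0_S: "potential R A T0 \<ge> 11 * int (card (T0 \<inter> B)) + 11 * int (card (T0 \<inter> C)) - 2"
      using pot_S by simp
    have AB: "A \<inter> B = {}" using A_outside I_S by (auto simp: B_def)
    have "card (T0 \<inter> A') = card (T0 \<inter> A) + card (T0 \<inter> B)"
    proof -
      have "T0 \<inter> A' = (T0 \<inter> A) \<union> (T0 \<inter> B)" "(T0 \<inter> A) \<inter> (T0 \<inter> B) = {}"
        using T0 AB p by (auto simp: A'_def)
      then show ?thesis using T0 by (simp add: card_Un_disjoint)
    qed
    moreover have "card (T0 - A) = card (T0 - A') + card (T0 \<inter> B)"
    proof -
      have "T0 - A = (T0 - A') \<union> (T0 \<inter> B)" "(T0 - A') \<inter> (T0 \<inter> B) = {}"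
        using T0 AB p by (auto simp: A'_def)
      then show ?thesis using T0 by (simp add: card_Un_disjoint)
    qed
    moreover have "edges_in R' T0 = edges_in R T0"
    proof -
      have "R' u k \<longleftrightarrow> R u k" if "u \<in> T0" "k \<in> T0" for u k
        using that T0 p by (auto simp: R'_def)
      then show ?thesis unfolding edges_in_def by blast
    qed
    ultimately have pot_T0: "potential R' A' T0 = potential R A T0 - 8 * int (card (T0 \<inter> B))"
      by (simp add: potential_def)
    \<comment> \<open>Each vertex of \<open>B\<close> gains 11 from its edge to \<open>S\<close> and
      loses 8 by precolouring; the surplus 3 beats the deficit 2 as soon as \<open>T0\<close> meets
      \<open>B\<close>. If \<open>p\<close> is in \<open>T\<close>, the edges to \<open>C\<close>
      cancel and the weight 5 of \<open>p\<close> beats the deficit.\<close>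
    show "potential R' A' T \<ge> 1"
    proof (cases "p \<in> T")
      case True
      then have "T = insert p T0" by (auto simp: T0_def)
      moreover have "p \<notin> T0" "p \<in> A'" by (auto simp: T0_def A'_def)
      moreover have "nbh R' T0 p = T0 \<inter> C" using T0 p CS by (auto simp: nbh_def R'_def)
      ultimately have "potential R' A' T = potential R' A' T0 + 5 - 11 * int (card (T0 \<inter> C))"
        using R'.potential_insert[OF T0(2), of p A'] by (simp add: deg_def)
      then show ?thesis using T0_S pot_T0 by linarith
    next
      case False
      then have T_T0: "T = T0" by (auto simp: T0_def)
      have "potential R A T0 \<ge> 1" using T T0 T_T0 by (intro potential_ge_1) auto
      moreover have "card (T0 \<inter> B) = 0 \<or> card (T0 \<inter> B) \<ge> 1" by linarith
      ultimately show ?thesis using T0_S pot_T0 unfolding T_T0 by linarith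
    qed
  qed
  moreover have "card V' < card V"
  proof -
    have "card V' = card (V - S) + 1" using p by (simp add: V'_def)
    also have "\<dots> = card V - card S + 1" using S by (simp add: card_Diff_subset fin_S psubset_imp_subset)
    finally show ?thesis using card_S \<open>card S < card V\<close> by linarith
  qed
  moreover have "finite V'" by (simp add: V'_def)
  ultimately obtain I' where I': "good R' A' V' I'"
    using smaller_good R'.sgraph_axioms by blast
  have pI': "p \<notin> I'" and BI': "B \<inter> I' = {}" and I'_sub: "I' \<subseteq> V - S - A"
    using I' by (auto simp: good_def A'_def V'_def)
  have good_S: "k \<notin> A" "k \<notin> I" "j \<in> I \<Longrightarrow> R k j \<Longrightarrow> j = i" if "k \<in> S" "i \<in> I" "R k i" for k i j
    using I that by (auto simp: good_def)
  have good_S': "k \<notin> A'" "k \<notin> I'" "j \<in> I' \<Longrightarrow> R' k j \<Longrightarrow> j = i" if "k \<in> V'" "i \<in> I'" "R' k i" for k i j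
    using I' that by (auto simp: good_def)
  have no_cross: "\<not> R k i" if "k \<in> S" "i \<in> I'" for k i
  proof
    assume ki: "R k i"
    have i: "i \<in> V - S" using that I'_sub by blast
    show False
    proof (cases "k \<in> I")
      case True
      then have "i \<in> B" using i ki sym by (auto simp: B_def)
      then show False using that BI' by blast
    next
      case False
      then have "R' p i" using i ki sym that by (auto simp: R'_def C_def)
      moreover have "p \<in> V'" "p \<in> A'" by (auto simp: V'_def A'_def)
      ultimately show False using good_S'(1) that by blast
    qed
  qed
  have "acyclic_on R (V - (I \<union> I'))"
    unfolding acyclic_on_def
  proof (intro allI impI)
    fix W assume W: "W \<subseteq> V - (I \<union> I')" "W \<noteq> {}"
    define W1 where "W1 = W \<inter> S"
    define W2 where "W2 = W - S"
    have W12: "W = W1 \<union> W2" "W2 \<subseteq> V - S - I'" "W1 \<subseteq> S - I" using W by (auto simp: W1_def W2_def)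
    have ac': "\<exists>w\<in>X. few R' X w" if "X \<subseteq> V' - I'" "X \<noteq> {}" for X
      using I' that by (auto simp: good_def acyclic_on_def)
    have R'R: "R' x y \<longleftrightarrow> R x y" if "x \<in> W2" "y \<in> W2" for x y
      using that W12 p by (auto simp: R'_def)
    show "\<exists>w\<in>W. few R W w"
    proof (cases "W1 = {}")
      case True
      then have "W = W2" using W12 by simp
      moreover have "\<exists>w\<in>W2. few R' W2 w"
        using W12 W calculation by (intro ac') (auto simp: V'_def)
      ultimately show ?thesis using R'R by (auto simp: few_def)
    next
      case False
      \<comment> \<open>Here \<open>p\<close> stands for all of \<open>W1\<close>. A leaf other than
        \<open>p\<close> is a leaf of \<open>W\<close>, as it sends at most one edge to
        \<open>S\<close>. If the leaf is \<open>p\<close>, at most one edge joins \<open>W1\<close>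
        and \<open>W2\<close>, and a leaf of \<open>W1\<close> away from that edge works, or the
        only vertex of \<open>W1\<close>.\<close>
      obtain w where w: "w \<in> insert p W2" "few R' (insert p W2) w"
        using ac'[of "insert p W2"] W12 pI' by (auto simp: V'_def)
      have to_p: "R' x p" "R' p x" if "x \<in> W2" "y \<in> W1" "R x y" for x y
        using that W12 by (auto simp: R'_def C_def)
      show ?thesis
      proof (cases "w \<in> W2")
        case True
        have "few R W w"
        proof (rule fewI)
          fix x y assume xy: "x \<in> W" "y \<in> W" "R w x" "R w y"
          have mixed: False if "x \<in> W1" "y \<in> W2" "R w x" "R w y" for x y
          proof -
            have "R' w p" "R' w y" using that True to_p R'R by auto
            then have "p = y" using fewD[OF w(2)] that by blast
            then show False using that W12 p by blast
          qed
          consider "x \<in> W1" "y \<in> W1" | "x \<in> W2" "y \<in> W2" | "x \<in> W1" "y \<in> W2" | "x \<in> W2" "y \<in> W1"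
            using xy W12 by blast
          then show "x = y"
          proof cases
            case 1
            then show ?thesis using unique[of w x y] True W12 xy by blast
          next
            case 2
            then show ?thesis using fewD[OF w(2), of x y] True R'R xy by blast
          qed (use mixed xy in blast)+
        qed
        then show ?thesis using True W12 by blast
      next
        case False
        then have wp: "w = p" using w by blast
        have one_edge: "x = x' \<and> y = y'" if "x \<in> W2" "y \<in> W1" "R x y" "x' \<in> W2" "y' \<in> W1" "R x' y'" for x y x' y'
        proof -
          have "x = x'" using fewD[OF w(2), of x x'] to_p that wp by blast
          then show ?thesis using unique[of x y y'] that W12 by blast
        qed
        obtain s where s: "s \<in> W1" "\<And>x y. x \<in> W2 \<Longrightarrow> y \<in> W1 \<Longrightarrow> R x y \<Longrightarrow> y = s"
        proof (cases "\<exists>x\<in>W2. \<exists>y\<in>W1. R x y")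
          case True
          then obtain x y where "x \<in> W2" "y \<in> W1" "R x y" by blast
          then show ?thesis using that[of y] one_edge by blast
        next
          case False
          then show ?thesis using that \<open>W1 \<noteq> {}\<close> by blast
        qed
        have "acyclic_on R (S - I)" using I by (simp add: good_def)
        then obtain l where l: "l \<in> W1" "few R W1 l" "l \<noteq> s \<or> W1 = {s}"
          using acyclic_on_two_leaves[of "S - I" W1 s] W12 s fin_S finite_subset[of W1 S] by blast
        have "few R W l"
        proof (rule fewI)
          fix x y assume xy: "x \<in> W" "y \<in> W" "R l x" "R l y"
          show "x = y"
          proof (cases "l = s")
            case True
            then have "x \<in> W2" "y \<in> W2" using xy l W12 irrefl by auto
            then show ?thesis using one_edge[of x l y l] xy sym l by blast
          next
            case False
            then have "x \<in> W1" "y \<in> W1" using xy l s W12 sym by blast+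
            then show ?thesis using l(2) xy by (auto dest: fewD)
          qed
        qed
        then show ?thesis using l W12 by blast
      qed
    qed
  qed
  moreover have "k \<notin> A \<and> k \<notin> I \<union> I' \<and> (\<forall>j \<in> I \<union> I'. R k j \<longrightarrow> j = i)"
    if k: "k \<in> V" and i: "i \<in> I \<union> I'" and ki: "R k i" for k i
  proof (cases "k \<in> S")
    case True
    then have iI: "i \<in> I" using no_cross ki i by blast
    moreover have "k \<notin> I'" using True I'_sub by blast
    ultimately show ?thesis using good_S[OF True iI ki] no_cross[OF True] by blast
  next
    case False
    then have kS: "k \<in> V - S" "k \<in> V'" using k by (auto simp: V'_def)
    have R'k: "R' k j" if "R k j" "j \<in> I'" for j
      using that I'_sub kS by (auto simp: R'_def)
    show ?thesis
    proof (cases "i \<in> I")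
      case True
      then have kB: "k \<in> B" using kS ki by (auto simp: B_def)
      then have kA': "k \<in> A'" by (simp add: A'_def)
      have "k \<notin> A" using A_outside kS ki True I_S by blast
      moreover have "k \<notin> I \<union> I'" using kB BI' kS I_S by blast
      moreover have "j = i" if j: "j \<in> I \<union> I'" "R k j" for j
      proof (cases "j \<in> I")
        case jI: True
        then show ?thesis using unique[OF kS(1), of j i] True ki I_S that by blast
      next
        case False
        then show ?thesis using good_S'(1)[OF kS(2), of j] R'k j kA' by blast
      qed
      ultimately show ?thesis by blast
    next
      case False
      then have iI': "i \<in> I'" using i by blast
      have 1: "k \<notin> A'" "k \<notin> I'" "\<And>j. j \<in> I' \<Longrightarrow> R' k j \<Longrightarrow> j = i"
        using good_S'[OF kS(2) iI' R'k[OF ki iI']] by blast+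
      then have "k \<notin> B" "k \<notin> A" using kS by (auto simp: A'_def)
      then have "\<not> R k j" if "j \<in> I" for j using that kS by (auto simp: B_def)
      then show ?thesis using 1 \<open>k \<notin> A\<close> kS I_S R'k by blast
    qed
  qed
  moreover have "I \<union> I' \<subseteq> V - A" using I_S I'_sub S by blast
  ultimately have "good R A V (I \<union> I')" unfolding good_def by blast
  then show False using not_good by blast
qed

subsection \<open>Reducible configurations\<close>

definition two_vertex :: "'a \<Rightarrow> bool" where
  "two_vertex u \<longleftrightarrow> u \<in> V - A \<and> deg R V u = 2"

lemma nbh_V: "nbh R V u = {k. R u k}"
  using edge_in_V' by (auto simp: nbh_def)

lemma delete:
  assumes "D \<subseteq> V" "D \<noteq> {}"
  obtains I where "good R A (V - D) I"
proof -
  have "card (V - D) < card V"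
    using assms by (intro psubset_card_mono) auto
  then show ?thesis
    using that smaller_good[of "V - D" R A] sparse_mono[OF sparse, of "V - D"] sgraph_axioms by auto
qed

text \<open>All neighbours of \<open>J\<close> lie in \<open>D\<close>, so vertices outside
  \<open>D\<close> see no new independent vertex. Only the vertices of \<open>D\<close> and
  acyclicity remain to be checked.\<close>

lemma no_extension:
  assumes I: "good R A (V - D) I" and J: "J \<subseteq> D - A" "D \<subseteq> V"
    and nbJ: "\<forall>j\<in>J. \<forall>k. R j k \<longrightarrow> k \<in> D"
    and D: "\<forall>k\<in>D. \<forall>i. R k i \<longrightarrow> i \<in> I \<union> J \<longrightarrow> k \<notin> A \<and> k \<notin> J"
    and unique: "\<forall>k\<in>D. \<forall>i. R k i \<longrightarrow> i \<in> I \<union> J \<longrightarrow> (\<forall>j. R k j \<longrightarrow> j \<in> I \<union> J \<longrightarrow> i = j)"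
    and acyclic: "acyclic_on R ((V - D - I) \<union> (D - J))"
  shows False
proof -
  have I_sub: "I \<subseteq> V - D - A" using I by (auto simp: good_def)
  have "V - (I \<union> J) = (V - D - I) \<union> (D - J)" using I_sub J by blast
  then have "acyclic_on R (V - (I \<union> J))" using acyclic by simp
  moreover have "k \<notin> A \<and> k \<notin> I \<union> J \<and> (\<forall>j \<in> I \<union> J. R k j \<longrightarrow> j = i)"
    if "k \<in> V" "i \<in> I \<union> J" "R k i" for k i
  proof (cases "k \<in> D")
    case True
    then show ?thesis using that D unique I_sub by blast
  next
    case False
    then have "j \<notin> J" if "R k j" for j using nbJ that sym by blast
    then show ?thesis using I that False J(1) unfolding good_def by blast
  qed
  moreover have "I \<union> J \<subseteq> V - A" using I_sub J by blast
  ultimately have "good R A V (I \<union> J)" unfolding good_def by blast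
  then show False using not_good by blast
qed

lemma no_attachment:
  assumes "good R A (V - D) I" "J \<subseteq> D - A" "D \<subseteq> V"
    and "\<forall>j\<in>J. \<forall>k. R j k \<longrightarrow> k \<in> D"
    and "\<forall>k\<in>D. \<forall>i. R k i \<longrightarrow> i \<in> I \<union> J \<longrightarrow> k \<notin> A \<and> k \<notin> J"
    and "\<forall>k\<in>D. \<forall>i. R k i \<longrightarrow> i \<in> I \<union> J \<longrightarrow> (\<forall>j. R k j \<longrightarrow> j \<in> I \<union> J \<longrightarrow> i = j)"
    and xs: "set xs = D - J" "attachable R (V - D - I) xs"
  shows False
proof -
  have "acyclic_on R (V - D - I)" using assms(1) by (simp add: good_def)
  then have "acyclic_on R ((V - D - I) \<union> (D - J))"
    using acyclic_on_attachable xs by metis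
  then show False by (rule no_extension[OF assms(1-6)])
qed

lemmas check_simps = few_iff all_conj_distrib

lemma good_subset: "good R A (V - D) I \<Longrightarrow> I \<subseteq> V - D"
  by (auto simp: good_def)

lemma two_vertexE:
  assumes "two_vertex u" "R u v"
  obtains a where "a \<noteq> v" "\<And>k. R u k \<longleftrightarrow> k = v \<or> k = a"
proof -
  have "card (nbh R V u) = 2" using assms by (simp add: two_vertex_def deg_def)
  then obtain p q where "p \<noteq> q" "nbh R V u = {p, q}" by (auto simp: card_2_iff)
  then have "p \<noteq> q" "\<And>k. R u k \<longleftrightarrow> k = p \<or> k = q" by (auto simp: nbh_V)
  then show ?thesis using assms that by metis
qed

lemma three_vertexE:
  assumes "deg R V u = 3" "R u x" "R u y" "x \<noteq> y"
  obtains z where "z \<noteq> x" "z \<noteq> y" "\<And>k. R u k \<longleftrightarrow> k = x \<or> k = y \<or> k = z"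
proof -
  have "card (nbh R V u) = 3" using assms by (simp add: deg_def)
  then have "card (nbh R V u - {x, y}) = 1"
    using assms by (subst card_Diff_subset) (auto simp: nbh_V)
  then obtain z where "nbh R V u - {x, y} = {z}" by (auto simp: card_1_singleton_iff)
  then have "z \<noteq> x" "z \<noteq> y" "nbh R V u = {x, y, z}"
    using assms by (auto simp: nbh_V)
  then show ?thesis using that by (auto simp: nbh_V)
qed

lemma two_vertex_in: "two_vertex u \<Longrightarrow> u \<in> V" "two_vertex u \<Longrightarrow> u \<notin> A"
  by (auto simp: two_vertex_def)

section \<open>Small degrees and short paths of vertices of degree 2\<close>

lemma deg_ge_2:
  assumes "u \<in> V - A"
  shows "deg R V u \<ge> 2"
proof (rule ccontr)
  assume "\<not> ?thesis"
  then have "card (nbh R V u) \<le> 1" by (simp add: deg_def)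
  then have few: "x = y" if "R u x" "R u y" for x y
    using card_le_Suc0_iff_eq[of "nbh R V u"] that by (simp add: nbh_V[symmetric]) (simp add: nbh_V)
  obtain I where I: "good R A (V - {u}) I"
    using delete[of "{u}"] assms by blast
  show False
    by (rule no_attachment[OF I, of "{}" "[u]"]) (use assms few in \<open>auto simp: few_def dest: few\<close>)
qed

lemma deg_ge_1:
  assumes "u \<in> V"
  shows "deg R V u \<ge> 1"
proof (rule ccontr)
  assume "\<not> ?thesis"
  then have "nbh R V u = {}" using finite_nbh[OF finite_V, of R u] by (simp add: deg_def not_le)
  then have none: "\<not> R u x" for x by (auto simp: nbh_V)
  obtain I where I: "good R A (V - {u}) I"
    using delete[of "{u}"] assms by blast
  show False
    by (rule no_attachment[OF I, of "{}" "[u]"]) (use assms none in \<open>auto simp: few_def\<close>)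
qed

text \<open>A precoloured vertex of degree 1 has charge 1 and could not pay a neighbour of degree 2.
  The pair is reducible: it hangs from the rest by one edge, so both vertices can join the
  forest.\<close>

lemma leaf_not_adjacent_two_vertex:
  assumes "two_vertex u" "R u p" "p \<in> A"
  shows "deg R V p \<ge> 2"
proof (rule ccontr)
  assume "\<not> ?thesis"
  then have "card (nbh R V p) \<le> 1" by (simp add: deg_def)
  moreover have "u \<in> nbh R V p" using assms sym by (auto simp: nbh_V)
  ultimately have "nbh R V p = {u}"
    by (metis card_le_Suc0_iff_eq One_nat_def finite_V finite_nbh insertCI subsetI subset_singletonD emptyE)
  then have p: "R p k \<longleftrightarrow> k = u" for k by (auto simp: nbh_V)
  obtain b where u: "b \<noteq> p" "\<And>k. R u k \<longleftrightarrow> k = p \<or> k = b"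
    using two_vertexE[OF assms(1,2)] by blast
  have D: "{p, u} \<subseteq> V" using assms two_vertex_in edge_in_V' by blast
  obtain I where I: "good R A (V - {p, u}) I"
    using delete[OF D] by blast
  have "I \<subseteq> V - {p, u}" using I by (auto simp: good_def)
  then show False using two_vertex_in[OF assms(1)] D
    by (intro no_attachment[OF I, of "{}" "[u, p]"]) (auto simp: few_def u p)
qed

text \<open>If neither outer end of the path is in the independent set, \<open>v\<close> can enter
  it. Otherwise the path is cut at that end, and all three vertices can join the forest.\<close>

lemma no_three_two_vertices:
  assumes "two_vertex u" "two_vertex v" "two_vertex w" "R v u" "R v w" "u \<noteq> w"
  shows False
proof -
  have v: "R v k \<longleftrightarrow> k = u \<or> k = w" for k
    using two_vertexE[OF assms(2,4)] assms(5,6) by metis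
  obtain a where a: "a \<noteq> v" "\<And>k. R u k \<longleftrightarrow> k = v \<or> k = a"
    using two_vertexE[OF assms(1)] assms(4) sym by metis
  obtain b where b: "b \<noteq> v" "\<And>k. R w k \<longleftrightarrow> k = v \<or> k = b"
    using two_vertexE[OF assms(3)] assms(5) sym by metis
  have ne: "u \<noteq> v" "w \<noteq> v" using assms irrefl by blast+
  have D: "{u, v, w} \<subseteq> V" "u \<notin> A" "v \<notin> A" "w \<notin> A" using assms two_vertex_in by blast+
  obtain I where I: "good R A (V - {u, v, w}) I"
    using delete[OF D(1)] by blast
  have DI: "u \<notin> I" "v \<notin> I" "w \<notin> I" using good_subset[OF I] by auto
  consider "a \<notin> I" "b \<notin> I" | "a \<in> I" | "b \<in> I" by blast
  then show False
  proof cases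
    case 1
    show False
      by (rule no_attachment[OF I _ D(1), of "{v}" "[u, w]"]) (use 1 in \<open>auto simp: check_simps a b v ne DI D ne[symmetric] assms(6)\<close>)
  next
    case 2
    show False
      by (rule no_attachment[OF I _ D(1), of "{}" "[w, v, u]"]) (use 2 in \<open>auto simp: check_simps a b v ne DI D ne[symmetric] assms(6)\<close>)
  next
    case 3
    show False
      by (rule no_attachment[OF I _ D(1), of "{}" "[u, v, w]"]) (use 3 in \<open>auto simp: check_simps a b v ne DI D ne[symmetric] assms(6)\<close>)
  qed
qed

text \<open>The triangle is broken at \<open>v\<close>, or at \<open>x\<close> if \<open>v\<close>
  is barred because \<open>c\<close> is in the independent set; in that case \<open>z\<close> is a
  dead end.\<close>

lemma no_triangle_two_vertices:
  assumes v: "v \<in> V - A" "deg R V v = 3" "R v x" "R v y" "R v z" "x \<noteq> y" "x \<noteq> z" "y \<noteq> z"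
    and two: "two_vertex x" "two_vertex y" "two_vertex z" and "R x y"
  shows False
proof -
  have nv: "R v k \<longleftrightarrow> k = x \<or> k = y \<or> k = z" for k
    using three_vertexE[OF v(2,3,4,6)] v(5-) by metis
  have nx: "R x k \<longleftrightarrow> k = v \<or> k = y" for k
    using two_vertexE[OF two(1)] v(3,4) \<open>R x y\<close> sym irrefl by metis
  have ny: "R y k \<longleftrightarrow> k = v \<or> k = x" for k
    using two_vertexE[OF two(2)] v(3,4) \<open>R x y\<close> sym irrefl by metis
  obtain c where c: "c \<noteq> v" "\<And>k. R z k \<longleftrightarrow> k = v \<or> k = c"
    using two_vertexE[OF two(3)] v(5) sym by metis
  have ne: "x \<noteq> v" "y \<noteq> v" "z \<noteq> v" using v irrefl by blast+
  have D: "{v, x, y, z} \<subseteq> V" "v \<notin> A" "x \<notin> A" "y \<notin> A" "z \<notin> A" using v two two_vertex_in by blast+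
  obtain I where I: "good R A (V - {v, x, y, z}) I"
    using delete[OF D(1)] by blast
  have DI: "v \<notin> I" "x \<notin> I" "y \<notin> I" "z \<notin> I" using good_subset[OF I] by auto
  note facts = nv nx ny c ne DI D v(6-8) ne[symmetric] v(6-8)[symmetric]
  show False
  proof (cases "c \<in> I")
    case True
    show False
      by (rule no_attachment[OF I _ D(1), of "{x}" "[z, v, y]"])
        (use True DI in \<open>auto simp: check_simps facts\<close>)
  next
    case False
    show False
      by (rule no_attachment[OF I _ D(1), of "{v}" "[y, x, z]"])
        (use False DI in \<open>auto simp: check_simps facts\<close>)
  qed
qed

text \<open>Rules out the vertices of degree 3 that would have to pay 4 + 2 + 2 out of a charge of
  7.\<close>

lemma no_three_two_neighbours:
  assumes v: "v \<in> V - A" "deg R V v = 3" "R v x" "R v y" "R v z" "x \<noteq> y" "x \<noteq> z" "y \<noteq> z"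
    and two: "two_vertex x" "two_vertex y" "two_vertex z" "two_vertex x'" and "R x x'"
  shows False
proof (cases "x' = y \<or> x' = z")
  case True
  then show False
    using no_triangle_two_vertices[OF v two(1-3)] no_triangle_two_vertices[OF v(1-3,5,4,7,6) v(8)[symmetric] two(1,3,2)]
      \<open>R x x'\<close> by blast
next
  case False
  have nv: "R v k \<longleftrightarrow> k = x \<or> k = y \<or> k = z" for k
    using three_vertexE[OF v(2,3,4,6)] v(5-) by metis
  have "x' \<noteq> v" using two(4) v(2) by (auto simp: two_vertex_def)
  then have nx: "R x k \<longleftrightarrow> k = v \<or> k = x'" for k
    using two_vertexE[OF two(1)] v(3) \<open>R x x'\<close> sym irrefl by metis
  obtain a where a: "a \<noteq> x" "\<And>k. R x' k \<longleftrightarrow> k = x \<or> k = a"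
    using two_vertexE[OF two(4)] \<open>R x x'\<close> sym by metis
  obtain b where b: "b \<noteq> v" "\<And>k. R y k \<longleftrightarrow> k = v \<or> k = b"
    using two_vertexE[OF two(2)] v(4) sym by metis
  obtain c where c: "c \<noteq> v" "\<And>k. R z k \<longleftrightarrow> k = v \<or> k = c"
    using two_vertexE[OF two(3)] v(5) sym by metis
  have ne: "x \<noteq> v" "y \<noteq> v" "z \<noteq> v" "x \<noteq> x'" "y \<noteq> x'" "z \<noteq> x'" "v \<noteq> x'"
    using v irrefl \<open>R x x'\<close> False \<open>x' \<noteq> v\<close> by blast+
  have D: "{v, x, x', y, z} \<subseteq> V" "v \<notin> A" "x \<notin> A" "x' \<notin> A" "y \<notin> A" "z \<notin> A"
    using v two two_vertex_in by blast+
  obtain I where I: "good R A (V - {v, x, x', y, z}) I"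
    using delete[OF D(1)] by blast
  have DI: "v \<notin> I" "x \<notin> I" "x' \<notin> I" "y \<notin> I" "z \<notin> I" using good_subset[OF I] by auto
  note facts = nv nx a b c ne DI D v(6-8) ne[symmetric] v(6-8)[symmetric]
  \<comment> \<open>If neither \<open>b\<close> nor \<open>c\<close> is in \<open>I\<close>, then
    \<open>v\<close> is added. If two of the three outer ends are in \<open>I\<close>, their
    branches are dead ends and everything joins the forest. In the remaining cases \<open>x\<close>
    is added, and exactly one of the branches at \<open>y\<close> and \<open>z\<close> is a dead
    end.\<close>
  consider "b \<notin> I" "c \<notin> I" | "b \<in> I" "c \<in> I" | "a \<in> I" "b \<in> I" | "a \<in> I" "c \<in> I"
    | "a \<notin> I" "b \<in> I" "c \<notin> I" | "a \<notin> I" "b \<notin> I" "c \<in> I" by blast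
  then show False
  proof cases
    case 1
    show False
      by (rule no_attachment[OF I _ D(1), of "{v}" "[x', y, z, x]"])
        (use 1 DI in \<open>auto simp: check_simps facts\<close>)
  next
    case 2
    show False
      by (rule no_attachment[OF I _ D(1), of "{}" "[x', x, v, y, z]"])
        (use 2 DI in \<open>auto simp: check_simps facts\<close>)
  next
    case 3
    show False
      by (rule no_attachment[OF I _ D(1), of "{}" "[z, v, y, x, x']"])
        (use 3 DI in \<open>auto simp: check_simps facts\<close>)
  next
    case 4
    show False
      by (rule no_attachment[OF I _ D(1), of "{}" "[y, v, z, x, x']"])
        (use 4 DI in \<open>auto simp: check_simps facts\<close>)
  next
    case 5
    show False
      by (rule no_attachment[OF I _ D(1), of "{x}" "[x', z, v, y]"])
        (use 5 DI in \<open>auto simp: check_simps facts\<close>)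
  next
    case 6
    show False
      by (rule no_attachment[OF I _ D(1), of "{x}" "[x', y, v, z]"])
        (use 6 DI in \<open>auto simp: check_simps facts\<close>)
  qed
qed

text \<open>
  Two adjacent vertices \<open>v\<close> and \<open>w\<close> of degree 3. The paths \<open>v, x, x', a\<close> and \<open>v, y, y', b\<close>
  start at \<open>v\<close>, the paths \<open>w, s, s', c\<close> and \<open>w, t, t', d\<close> start at \<open>w\<close>.
\<close>

definition twin :: "'a \<Rightarrow> 'a \<Rightarrow> 'a \<Rightarrow> 'a \<Rightarrow> 'a \<Rightarrow> 'a \<Rightarrow> 'a \<Rightarrow> 'a \<Rightarrow> 'a \<Rightarrow> 'a \<Rightarrow> 'a \<Rightarrow> 'a \<Rightarrow> 'a \<Rightarrow> 'a \<Rightarrow> bool" where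
  "twin v x x' a y y' b w s s' c t t' d \<longleftrightarrow>
     (\<forall>k. R v k \<longleftrightarrow> k = x \<or> k = y \<or> k = w) \<and> (\<forall>k. R w k \<longleftrightarrow> k = v \<or> k = s \<or> k = t) \<and>
     (\<forall>k. R x k \<longleftrightarrow> k = v \<or> k = x') \<and> (\<forall>k. R x' k \<longleftrightarrow> k = x \<or> k = a) \<and>
     (\<forall>k. R y k \<longleftrightarrow> k = v \<or> k = y') \<and> (\<forall>k. R y' k \<longleftrightarrow> k = y \<or> k = b) \<and>
     (\<forall>k. R s k \<longleftrightarrow> k = w \<or> k = s') \<and> (\<forall>k. R s' k \<longleftrightarrow> k = s \<or> k = c) \<and>
     (\<forall>k. R t k \<longleftrightarrow> k = w \<or> k = t') \<and> (\<forall>k. R t' k \<longleftrightarrow> k = t \<or> k = d) \<and>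
     distinct [v, w, x, x', y, y', s, s', t, t'] \<and>
     {v, w, x, x', y, y', s, s', t, t'} \<subseteq> V - A \<and>
     {a, b, c, d} \<subseteq> V - {v, w, x, x', y, y', s, s', t, t'}"

lemma twin_swap_left: "twin v x x' a y y' b w s s' c t t' d \<Longrightarrow> twin v y y' b x x' a w s s' c t t' d"
  unfolding twin_def by (elim conjE, intro conjI) auto

lemma twin_swap_right: "twin v x x' a y y' b w s s' c t t' d \<Longrightarrow> twin v x x' a y y' b w t t' d s s' c"
  unfolding twin_def by (elim conjE, intro conjI) auto

lemma twin_nb:
  assumes "twin v x x' a y y' b w s s' c t t' d"
  shows "R v k \<longleftrightarrow> k = x \<or> k = y \<or> k = w" "R w k \<longleftrightarrow> k = v \<or> k = s \<or> k = t"
    "R x k \<longleftrightarrow> k = v \<or> k = x'" "R x' k \<longleftrightarrow> k = x \<or> k = a"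
    "R y k \<longleftrightarrow> k = v \<or> k = y'" "R y' k \<longleftrightarrow> k = y \<or> k = b"
    "R s k \<longleftrightarrow> k = w \<or> k = s'" "R s' k \<longleftrightarrow> k = s \<or> k = c"
    "R t k \<longleftrightarrow> k = w \<or> k = t'" "R t' k \<longleftrightarrow> k = t \<or> k = d"
  using assms unfolding twin_def by simp_all

text \<open>
  If no such set exists, then \<open>v\<close>, \<open>w\<close> and the paths can be replaced with the path
  \<open>a, x', s', c\<close>. A partition of the smaller graph then extends with at most one of \<open>y\<close>, \<open>y'\<close>
  and one of \<open>t\<close>, \<open>t'\<close> in the independent set, while \<open>x', x, v, w, s, s'\<close> subdivides the edge
  \<open>x', s'\<close>.
\<close>

lemma twin_low_potential:
  assumes twin: "twin v x x' a y y' b w s s' c t t' d"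
  shows "\<exists>S \<subseteq> V - {v, w, x, x', y, y', s, s', t, t'}. a \<in> S \<and> c \<in> S \<and> potential R A S \<le> 7"
proof (rule ccontr)
  assume none: "\<not> ?thesis"
  have high: "potential R A S \<ge> 8" if "S \<subseteq> V - {v, w, x, x', y, y', s, s', t, t'}" "a \<in> S" "c \<in> S" for S
  proof -
    have "\<not> potential R A S \<le> 7" using none that by blast
    then show ?thesis by linarith
  qed
  note nb = twin_nb[OF twin]
  have dist: "distinct [v, w, x, x', y, y', s, s', t, t']"
    and H: "{v, w, x, x', y, y', s, s', t, t'} \<subseteq> V - A"
    and out: "{a, b, c, d} \<subseteq> V - {v, w, x, x', y, y', s, s', t, t'}"
    using twin unfolding twin_def by blast+
  have dist': "distinct [t', t, s', s, y', y, x', x, w, v]"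
    using distinct_rev[of "[v, w, x, x', y, y', s, s', t, t']"] dist by (simp only: rev.simps append.simps)
  note ne = dist[simplified] dist'[simplified]
  define D where "D = {v, w, x, y, y', s, t, t'}"
  define R' where "R' u k \<longleftrightarrow> R u k \<or> (u = x' \<and> k = s') \<or> (u = s' \<and> k = x')" for u k
  have D: "D \<subseteq> V" "D \<noteq> {}" using H by (auto simp: D_def)
  interpret R': sgraph R'
    using ne sym by unfold_locales (auto simp: R'_def)
  have "sparse R' A (V - D)"
    unfolding sparse_def
  proof (intro allI impI)
    fix T assume T: "T \<subseteq> V - D" "T \<noteq> {}"
    show "1 \<le> potential R' A T"
    proof (cases "x' \<in> T \<and> s' \<in> T")
      case False
      then have "potential R' A T = potential R A T"
        by (intro potential_cong) (auto simp: R'_def)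
      then show ?thesis using T potential_ge_1 by auto
    next
      case True
      define S where "S = T - {x', s'}"
      have S: "S \<subseteq> V - {v, w, x, x', y, y', s, s', t, t'}" using T by (auto simp: S_def D_def)
      have fin: "finite S" using S finite_subset_V[of S] by blast
      have "nbh R' S s' = (if c \<in> S then {c} else {})"
        using S ne by (auto simp: nbh_def R'_def nb)
      then have 1: "deg R' S s' = of_bool (c \<in> S)" by (simp add: deg_def)
      have "nbh R' (insert s' S) x' = (if a \<in> S then {s', a} else {s'})"
        using S ne out by (auto simp: nbh_def R'_def nb)
      moreover have "a \<noteq> s'" using out by auto
      ultimately have 2: "deg R' (insert s' S) x' = of_bool (a \<in> S) + 1" by (simp add: deg_def)
      have T_S: "T = insert x' (insert s' S)" using True by (auto simp: S_def)
      \<comment> \<open>The two vertices and the edges from \<open>a\<close> to \<open>x'\<close>,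
        \<open>x'\<close> to \<open>s'\<close> and \<open>s'\<close> to \<open>c\<close> weigh 26 -
        33 = -7, whence the threshold 8. If \<open>S\<close> misses \<open>a\<close> or
        \<open>c\<close>, the balance is at least 26 - 22 = 4.\<close>
      have "potential R' A T = potential R' A S + 26 - 11 * (of_bool (c \<in> S) + of_bool (a \<in> S) + 1)"
        unfolding T_S using fin S ne H 1 2
        by (subst R'.potential_insert, simp, force, subst R'.potential_insert, simp, force) auto
      also have "potential R' A S = potential R A S"
        by (rule potential_cong) (auto simp: R'_def S_def)
      finally have pot: "potential R' A T = potential R A S + 26 - 11 * (of_bool (c \<in> S) + of_bool (a \<in> S) + 1)" .
      have "potential R A S \<ge> 1" if "S \<noteq> {}"
        using S that by (intro potential_ge_1) auto
      moreover have "potential R A S = 0" if "S = {}" using that by simp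
      ultimately show ?thesis
        using pot high[OF S] by (cases "S = {}"; cases "a \<in> S"; cases "c \<in> S") auto
    qed
  qed
  moreover have "card (V - D) < card V"
    using D by (intro psubset_card_mono) auto
  ultimately obtain I where I': "good R' A (V - D) I"
    using smaller_good[of "V - D" R' A] R'.sgraph_axioms by auto
  have few: "few R W u" if "few R' W u" for W u
    using that by (auto simp: few_def R'_def)
  have I: "good R A (V - D) I"
  proof -
    have "acyclic_on R' (V - D - I)" using I' by (simp add: good_def)
    then have "acyclic_on R (V - D - I)" unfolding acyclic_on_def using few by blast
    moreover have "\<forall>k\<in>V - D. \<forall>i\<in>I. R' k i \<longrightarrow> k \<notin> A \<and> k \<notin> I \<and> (\<forall>j\<in>I. R' k j \<longrightarrow> j = i)"
      and "I \<subseteq> V - D - A" using I' unfolding good_def by blast+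
    then have "\<forall>k\<in>V - D. \<forall>i\<in>I. R k i \<longrightarrow> k \<notin> A \<and> k \<notin> I \<and> (\<forall>j\<in>I. R k j \<longrightarrow> j = i)" "I \<subseteq> V - D - A"
      unfolding R'_def by blast+
    ultimately show ?thesis unfolding good_def by blast
  qed
  define F where "F = V - D - I"
  have acyclic: "acyclic_on R (F \<union> {v, w, x, s})"
    unfolding acyclic_on_def
  proof (intro allI impI)
    fix W assume W: "W \<subseteq> F \<union> {v, w, x, s}" "W \<noteq> {}"
    have yt: "y \<notin> W" "t \<notin> W" using W ne by (auto simp: F_def D_def)
    \<comment> \<open>If part of the path \<open>x', x, v, w, s, s'\<close> is missing, an inner
      vertex next to the gap is a leaf, or \<open>W\<close> lies in \<open>F\<close>. If the whole
      path is present, it is shrunk back to the edge between \<open>x'\<close> and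
      \<open>s'\<close>.\<close>
    consider "x \<in> W" "x' \<notin> W \<or> v \<notin> W" | "v \<in> W" "x \<notin> W \<or> w \<notin> W" | "w \<in> W" "v \<notin> W \<or> s \<notin> W"
      | "s \<in> W" "s' \<notin> W \<or> w \<notin> W" | "W \<subseteq> F" | "{x', x, v, w, s, s'} \<subseteq> W"
      using W by blast
    then show "\<exists>u\<in>W. few R W u"
    proof cases
      case 1
      then show ?thesis by (intro bexI[of _ x]) (auto simp: few_def nb)
    next
      case 2
      then show ?thesis using yt by (intro bexI[of _ v]) (auto simp: few_def nb)
    next
      case 3
      then show ?thesis using yt by (intro bexI[of _ w]) (auto simp: few_def nb)
    next
      case 4
      then show ?thesis by (intro bexI[of _ s]) (auto simp: few_def nb)
    next
      case 5
      have "acyclic_on R F" using I by (simp add: good_def F_def)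
      then show ?thesis using 5 W by (auto simp: acyclic_on_def)
    next
      case 6
      define W0 where "W0 = W - {v, w, x, s}"
      have W0: "W0 \<subseteq> F" "x' \<in> W0" "s' \<in> W0" using W 6 ne by (auto simp: W0_def)
      have "acyclic_on R' F" using I' by (simp add: good_def F_def)
      then obtain u where u: "u \<in> W0" "few R' W0 u" using W0 unfolding acyclic_on_def by blast
      have a: "a \<in> W \<longleftrightarrow> a \<in> W0" "a \<noteq> s'" "c \<in> W \<longleftrightarrow> c \<in> W0" "c \<noteq> x'" using out by (auto simp: W0_def)
      have "few R W u"
      proof (cases "u = x' \<or> u = s'")
        case True
        then show ?thesis
        proof
          assume [simp]: "u = x'"
          have "a \<notin> W0"
            using fewD[OF u(2), of a s'] W0 a by (auto simp: R'_def nb)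
          then show ?thesis using a by (auto simp: few_def nb)
        next
          assume [simp]: "u = s'"
          have "c \<notin> W0"
            using fewD[OF u(2), of c x'] W0 a by (auto simp: R'_def nb)
          then show ?thesis using a by (auto simp: few_def nb)
        qed
      next
        case False
        have "u \<notin> D" using u W0 by (auto simp: F_def)
        then have "\<not> R v u" "\<not> R w u" "\<not> R x u" "\<not> R s u" using False by (auto simp: nb D_def)
        then have "k \<in> W0" if "k \<in> W" "R u k" for k
          using that sym by (auto simp: W0_def)
        then show ?thesis using few[OF u(2)] unfolding few_def by blast
      qed
      then show ?thesis using u by (auto simp: W0_def)
    qed
  qed
  have eqs: "b \<noteq> v" "b \<noteq> w" "b \<noteq> x" "b \<noteq> y" "b \<noteq> s" "b \<noteq> t" "b \<noteq> y'" "b \<noteq> t'"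
    "d \<noteq> v" "d \<noteq> w" "d \<noteq> x" "d \<noteq> y" "d \<noteq> s" "d \<noteq> t" "d \<noteq> y'" "d \<noteq> t'" using out by auto
  have DI: "v \<notin> I" "w \<notin> I" "x \<notin> I" "y \<notin> I" "y' \<notin> I" "s \<notin> I" "t \<notin> I" "t' \<notin> I"
    using good_subset[OF I] by (auto simp: D_def)
  have DF: "v \<notin> F" "w \<notin> F" "x \<notin> F" "y \<notin> F" "y' \<notin> F" "s \<notin> F" "t \<notin> F" "t' \<notin> F"
    by (auto simp: F_def D_def)
  \<comment> \<open>\<open>y\<close> is chosen rather than \<open>y'\<close> because both its
    neighbours are deleted. If \<open>b\<close> is in \<open>I\<close>, then \<open>y'\<close>
    already has its independent neighbour, and \<open>y, y'\<close> hang from \<open>v\<close> as a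
    dead end. Likewise for \<open>t\<close>.\<close>
  define J where "J = (if b \<in> I then {} else {y}) \<union> (if d \<in> I then {} else {t})"
  define xs where "xs = (if b \<in> I then [y, y'] else [y']) @ (if d \<in> I then [t, t'] else [t'])"
  have attachable: "attachable R (F \<union> {v, w, x, s}) xs"
  proof -
    have "b \<notin> F" if "b \<in> I" using that by (simp add: F_def)
    moreover have "d \<notin> F" if "d \<in> I" using that by (simp add: F_def)
    ultimately show ?thesis unfolding xs_def
      by (cases "b \<in> I"; cases "d \<in> I"; simp add: check_simps nb DF eqs ne eqs[symmetric])
  qed
  have "{v, w, x, s} \<union> set xs = D - J"
  proof -
    define K where "K = {v, w, x, s, y', t'}"
    have K: "y \<notin> K" "t \<notin> K" "y \<noteq> t" by (simp_all add: K_def ne)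
    have "D = insert y (insert t K)" unfolding D_def K_def by blast
    then have "D - J = K \<union> (if b \<in> I then {y} else {}) \<union> (if d \<in> I then {t} else {})"
      using K unfolding J_def by auto
    also have "\<dots> = {v, w, x, s} \<union> set xs" unfolding K_def xs_def by auto
    finally show ?thesis ..
  qed
  then have "F \<union> {v, w, x, s} \<union> set xs = V - D - I \<union> (D - J)"
    unfolding Un_assoc F_def by (rule arg_cong)
  then have acyclic': "acyclic_on R (V - D - I \<union> (D - J))"
    using acyclic_on_attachable[OF acyclic attachable] by (rule subst)
  have DA: "v \<notin> A" "w \<notin> A" "x \<notin> A" "y \<notin> A" "y' \<notin> A" "s \<notin> A" "t \<notin> A" "t' \<notin> A" using H by auto
  show False
    by (rule no_extension[OF I _ D(1) _ _ _ acyclic'])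
      (use ne DI eqs DA in \<open>auto simp: J_def D_def check_simps nb split: if_splits\<close>)
qed

text \<open>The sets through \<open>a, c\<close>, through \<open>a, d\<close> and through
  \<open>b, d\<close> overlap in \<open>a\<close> and then in \<open>d\<close>. Submodularity and
  the gap bound the potential of their union by 7 + 7 + 7 - 4 - 4 = 13, too little to absorb the
  configuration itself.\<close>

lemma no_twin: "\<not> twin v x x' a y y' b w s s' c t t' d"
proof
  assume twin: "twin v x x' a y y' b w s s' c t t' d"
  define H where "H = {v, w, x, x', y, y', s, s', t, t'}"
  have H: "H \<subseteq> V - A" and dist: "distinct [v, w, x, x', y, y', s, s', t, t']"
    using twin unfolding twin_def H_def by blast+
  have H_perm: "{v, w, y, y', x, x', s, s', t, t'} = H" "{v, w, x, x', y, y', t, t', s, s'} = H"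
    "{v, w, y, y', x, x', t, t', s, s'} = H" by (auto simp: H_def)
  obtain X where X: "X \<subseteq> V - H" "a \<in> X" "c \<in> X" "potential R A X \<le> 7"
    using twin_low_potential[OF twin] unfolding H_def by blast
  obtain Y where Y: "Y \<subseteq> V - H" "a \<in> Y" "d \<in> Y" "potential R A Y \<le> 7"
    using twin_low_potential[OF twin_swap_right[OF twin]] unfolding H_perm by blast
  obtain Z where Z: "Z \<subseteq> V - H" "b \<in> Z" "d \<in> Z" "potential R A Z \<le> 7"
    using twin_low_potential[OF twin_swap_right[OF twin_swap_left[OF twin]]] unfolding H_perm by blast
  have fin: "finite X" "finite Y" "finite Z" using X Y Z by (auto intro: finite_subset[of _ V])
  have "v \<in> V" "v \<in> H" using H by (auto simp: H_def)
  then have proper: "potential R A S \<ge> 4" if "S \<subseteq> V - H" "S \<noteq> {}" for S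
    using that by (intro potential_proper_subset) auto
  have "potential R A (X \<inter> Y) \<ge> 4" "potential R A ((X \<union> Y) \<inter> Z) \<ge> 4"
    using X Y Z by (intro proper; blast)+
  \<comment> \<open>The ten vertices of \<open>H\<close> and the thirteen edges at them weigh 130 - 143 = -13.\<close>
  moreover have "potential R A (X \<union> Y \<union> Z) \<ge> 14"
  proof -
    define S where "S = X \<union> Y \<union> Z"
    have S: "S \<subseteq> V - H" "finite S" "a \<in> S" "b \<in> S" "c \<in> S" "d \<in> S"
      using X Y Z fin by (auto simp: S_def)
    have nS: "v \<notin> S" "w \<notin> S" "x \<notin> S" "x' \<notin> S" "y \<notin> S" "y' \<notin> S" "s \<notin> S" "s' \<notin> S" "t \<notin> S" "t' \<notin> S"
      using S(1) by (auto simp: H_def)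
    have nA: "v \<notin> A" "w \<notin> A" "x \<notin> A" "x' \<notin> A" "y \<notin> A" "y' \<notin> A" "s \<notin> A" "s' \<notin> A" "t \<notin> A" "t' \<notin> A"
      using H by (auto simp: H_def)
    have nb: "R x' a" "R x x'" "R v x" "R y' b" "R y y'" "R y v" "R w v" "R s w" "R s' s" "R s' c"
      "R t' d" "R t t'" "R t w"
      by (simp_all add: twin_nb[OF twin])
    have "s \<noteq> c" using S nS by blast
    note ins = potential_insert_le[where A = A]
    \<comment> \<open>The order makes one or two known neighbours per vertex suffice; the four
      stages contribute 6 - 7 - 5 - 7 = -13.\<close>
    define S1 where "S1 = insert v (insert x (insert x' S))"
    have "potential R A S1 \<le> potential R A S + 6"
      using ins[of S x' "{a}"] ins[of "insert x' S" x "{x'}"] ins[of "insert x (insert x' S)" v "{x}"]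
        S nS nA nb dist by (simp add: S1_def)
    moreover define S2 where "S2 = insert y (insert y' S1)"
    have "potential R A S2 \<le> potential R A S1 - 7"
      using ins[of S1 y' "{b}"] ins[of "insert y' S1" y "{y', v}"]
        S nS nA nb dist by (auto simp: S2_def S1_def)
    moreover define S3 where "S3 = insert s' (insert s (insert w S2))"
    have "potential R A S3 \<le> potential R A S2 - 5"
      using ins[of S2 w "{v}"] ins[of "insert w S2" s "{w}"] ins[of "insert s (insert w S2)" s' "{s, c}"]
        \<open>s \<noteq> c\<close> S nS nA nb dist by (auto simp: S3_def S2_def S1_def)
    moreover have "potential R A (insert t (insert t' S3)) \<le> potential R A S3 - 7"
      using ins[of S3 t' "{d}"] ins[of "insert t' S3" t "{t', w}"]
        S nS nA nb dist by (auto simp: S3_def S2_def S1_def)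
    moreover have "potential R A (insert t (insert t' S3)) \<ge> 1"
      using S H by (intro potential_ge_1) (auto simp: S3_def S2_def S1_def H_def)
    ultimately show ?thesis unfolding S_def by linarith
  qed
  ultimately show False
    using potential_submodular[OF fin(1,2), of A] potential_submodular[of "X \<union> Y" Z A] fin X Y Z by simp
qed

section \<open>Degenerate positions of the paths at two adjacent vertices of degree 3\<close>

text \<open>A position not covered by \<open>twin\<close>: one path joins \<open>v\<close> to
  \<open>w\<close>. Putting \<open>v\<close> into the independent set breaks the 4-cycle, and the
  remaining vertices can be attached one after another.\<close>

lemma no_shared_thread:
  assumes v: "v \<in> V - A" "deg R V v = 3" and w: "w \<in> V - A" "deg R V w = 3" and "R v w"
    and x: "two_vertex x" "R v x" "R x s" and s: "two_vertex s" "R w s"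
    and y: "two_vertex y" "R v y" "y \<noteq> x" "two_vertex y'" "R y y'"
    and t: "two_vertex t" "R w t" "t \<noteq> s" "two_vertex t'" "R t t'"
  shows False
proof -
  have ne: "v \<noteq> w" "v \<noteq> x" "v \<noteq> s" "v \<noteq> y" "v \<noteq> t" "v \<noteq> y'" "v \<noteq> t'"
    "w \<noteq> x" "w \<noteq> s" "w \<noteq> y" "w \<noteq> t" "w \<noteq> y'" "w \<noteq> t'" "x \<noteq> s" "y \<noteq> y'" "t \<noteq> t'"
    using v w \<open>R v w\<close> x s y t irrefl unfolding two_vertex_def by auto
  have nv: "R v k \<longleftrightarrow> k = x \<or> k = y \<or> k = w" for k
    using three_vertexE[OF v(2) x(2) y(2)] y(3) \<open>R v w\<close> ne by metis
  have nw: "R w k \<longleftrightarrow> k = v \<or> k = s \<or> k = t" for k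
    using three_vertexE[OF w(2) s(2) t(2)] t(3) \<open>R v w\<close> sym ne by metis
  have nx: "R x k \<longleftrightarrow> k = v \<or> k = s" for k
    using two_vertexE[OF x(1,3)] x(2) sym ne by metis
  have ns: "R s k \<longleftrightarrow> k = w \<or> k = x" for k
    using two_vertexE[OF s(1), of w] s(2) x(3) sym ne by metis
  have ny: "R y k \<longleftrightarrow> k = v \<or> k = y'" for k
    using two_vertexE[OF y(1,5)] y(2) sym ne by metis
  have nt: "R t k \<longleftrightarrow> k = w \<or> k = t'" for k
    using two_vertexE[OF t(1,5)] t(2) sym ne by metis
  have "R x v" "\<not> R t v" "R s w" "\<not> R y w" "R y v"
    using ne by (auto simp: nx nt ns ny)
  then have far1: "x \<noteq> y" "x \<noteq> t" "s \<noteq> y" "s \<noteq> t" "y \<noteq> t"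
    using y(3) t(3) by blast+
  have far2: "x \<noteq> y'" "x \<noteq> t'" "s \<noteq> y'" "s \<noteq> t'"
    using nx[of y] nx[of t] ns[of y] ns[of t] sym[OF y(5)] sym[OF t(5)] far1 ne by auto
  note far = far1 far2
  note nes = ne far ne[symmetric] far[symmetric]
  have A: "v \<notin> A" "w \<notin> A" "x \<notin> A" "s \<notin> A" "y \<notin> A" "t \<notin> A" "y' \<notin> A" "t' \<notin> A"
    and in_V: "v \<in> V" "w \<in> V" "x \<in> V" "s \<in> V" "y \<in> V" "t \<in> V" "y' \<in> V" "t' \<in> V"
    using v w x s y t unfolding two_vertex_def by blast+
  show False
  \<comment> \<open>If \<open>y' = t\<close>, the second path joins \<open>v\<close> and
    \<open>w\<close> as well, and the six vertices form a whole component.\<close>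
  proof (cases "y' = t")
    case True
    have "t' = y" using ny nt True sym ne by metis
    have D: "{v, w, x, s, y, t} \<subseteq> V" using in_V by blast
    obtain I where I: "good R A (V - {v, w, x, s, y, t}) I" using delete[OF D] by blast
    have DI: "v \<notin> I" "w \<notin> I" "x \<notin> I" "s \<notin> I" "y \<notin> I" "t \<notin> I" using good_subset[OF I] by auto
    show False
      by (rule no_attachment[OF I _ D, of "{v}" "[y, t, w, s, x]"])
        (use DI in \<open>auto simp: check_simps nv nw nx ns ny nt \<open>y' = t\<close> \<open>t' = y\<close> nes A in_V\<close>)
  next
    case False
    obtain b where b: "b \<noteq> y" "\<And>k. R y' k \<longleftrightarrow> k = y \<or> k = b"
      using two_vertexE[OF y(4)] y(5) sym by metis
    obtain d where d: "d \<noteq> t" "\<And>k. R t' k \<longleftrightarrow> k = t \<or> k = d"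
      using two_vertexE[OF t(4)] t(5) sym by metis
    have "t' \<noteq> y" using False ny t(5) sym ne by metis
    have "y' \<noteq> t'" using no_three_two_vertices[OF y(1,4) t(1)] y(5) t(5) sym far by metis
    note nes' = nes \<open>t' \<noteq> y\<close> False \<open>y' \<noteq> t'\<close> \<open>t' \<noteq> y\<close>[symmetric] False[symmetric] \<open>y' \<noteq> t'\<close>[symmetric]
    have D: "{v, w, x, s, y, y', t, t'} \<subseteq> V" using in_V by blast
    obtain I where I: "good R A (V - {v, w, x, s, y, y', t, t'}) I" using delete[OF D] by blast
    have DI: "v \<notin> I" "w \<notin> I" "x \<notin> I" "s \<notin> I" "y \<notin> I" "y' \<notin> I" "t \<notin> I" "t' \<notin> I"
      using good_subset[OF I] by auto
    have "b \<noteq> v" "d \<noteq> v" using b(2)[of v] d(2)[of v] nv nes' sym by metis+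
    show False
      by (rule no_attachment[OF I _ D, of "{v}" "[y', y, t', t, w, s, x]"])
        (use DI \<open>b \<noteq> v\<close> \<open>d \<noteq> v\<close> in \<open>auto simp: check_simps nv nw nx ns ny nt b d nes' A in_V\<close>)
  qed
qed

text \<open>The other position not covered by \<open>twin\<close>: the two paths at \<open>v\<close>
  close up to a triangle, which \<open>x\<close> in the independent set breaks. If \<open>c\<close>
  is not in the independent set, \<open>s\<close> is added too, since otherwise the paths to
  \<open>c\<close> and \<open>d\<close> could close a cycle.\<close>

lemma no_triangle_twin:
  assumes v: "v \<in> V - A" "deg R V v = 3" and w: "w \<in> V - A" "deg R V w = 3" and "R v w"
    and x: "two_vertex x" "R v x" and y: "two_vertex y" "R v y" "R x y"
    and s: "two_vertex s" "R w s" "two_vertex s'" "R s s'"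
    and t: "two_vertex t" "R w t" "s \<noteq> t" "two_vertex t'" "R t t'"
  shows False
proof -
  have ne: "v \<noteq> w" "v \<noteq> x" "v \<noteq> y" "v \<noteq> s" "v \<noteq> t" "v \<noteq> s'" "v \<noteq> t'"
    "w \<noteq> x" "w \<noteq> s" "w \<noteq> y" "w \<noteq> t" "w \<noteq> s'" "w \<noteq> t'" "x \<noteq> y" "s \<noteq> s'" "t \<noteq> t'" "s \<noteq> t"
    using v w \<open>R v w\<close> x s y t irrefl unfolding two_vertex_def by auto
  have nv: "R v k \<longleftrightarrow> k = x \<or> k = y \<or> k = w" for k
    using three_vertexE[OF v(2) x(2) y(2)] \<open>R v w\<close> ne by metis
  have nw: "R w k \<longleftrightarrow> k = v \<or> k = s \<or> k = t" for k
    using three_vertexE[OF w(2) s(2) t(2)] t(3) \<open>R v w\<close> sym ne by metis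
  have nx: "R x k \<longleftrightarrow> k = v \<or> k = y" for k
    using two_vertexE[OF x(1) y(3)] x(2) sym ne by metis
  have ny: "R y k \<longleftrightarrow> k = v \<or> k = x" for k
    using two_vertexE[OF y(1), of v] y sym ne by metis
  have ns: "R s k \<longleftrightarrow> k = w \<or> k = s'" for k
    using two_vertexE[OF s(1,4)] s(2) sym ne by metis
  have nt: "R t k \<longleftrightarrow> k = w \<or> k = t'" for k
    using two_vertexE[OF t(1,5)] t(2) sym ne by metis
  have far1: "x \<noteq> s" "x \<noteq> t" "y \<noteq> s" "y \<noteq> t"
    using nx[of v] ny[of v] ns[of v] nt[of v] ne by auto
  have far2: "x \<noteq> s'" "x \<noteq> t'" "y \<noteq> s'" "y \<noteq> t'"
    using nx[of s] nx[of t] ny[of s] ny[of t] sym[OF s(4)] sym[OF t(5)] far1 ne by auto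
  note far = far1 far2
  note nes = ne far ne[symmetric] far[symmetric]
  have A: "v \<notin> A" "w \<notin> A" "x \<notin> A" "y \<notin> A" "s \<notin> A" "s' \<notin> A" "t \<notin> A" "t' \<notin> A"
    and in_V: "v \<in> V" "w \<in> V" "x \<in> V" "y \<in> V" "s \<in> V" "s' \<in> V" "t \<in> V" "t' \<in> V"
    using v w x s y t unfolding two_vertex_def by blast+
  show False
  proof (cases "s' = t")
    case True
    have "t' = s" using ns nt True sym ne by metis
    have D: "{v, x, y, w, s, t} \<subseteq> V" using in_V by blast
    obtain I where I: "good R A (V - {v, x, y, w, s, t}) I" using delete[OF D] by blast
    have DI: "v \<notin> I" "w \<notin> I" "x \<notin> I" "y \<notin> I" "s \<notin> I" "t \<notin> I" using good_subset[OF I] by auto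
    show False
      by (rule no_attachment[OF I _ D, of "{x, s}" "[v, y, w, t]"])
        (use DI in \<open>auto simp: check_simps nv nw nx ns ny nt \<open>s' = t\<close> \<open>t' = s\<close> nes A in_V\<close>)
  next
    case False
    obtain c where c: "c \<noteq> s" "\<And>k. R s' k \<longleftrightarrow> k = s \<or> k = c"
      using two_vertexE[OF s(3)] s(4) sym by metis
    obtain d where d: "d \<noteq> t" "\<And>k. R t' k \<longleftrightarrow> k = t \<or> k = d"
      using two_vertexE[OF t(4)] t(5) sym by metis
    have "t' \<noteq> s" using False ns t(5) sym ne by metis
    have "s' \<noteq> t'" using no_three_two_vertices[OF s(1,3) t(1)] s(4) t(5) sym ne by metis
    note nes' = nes \<open>t' \<noteq> s\<close> False \<open>s' \<noteq> t'\<close> \<open>t' \<noteq> s\<close>[symmetric] False[symmetric] \<open>s' \<noteq> t'\<close>[symmetric]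
    have D: "{v, x, y, w, s, s', t, t'} \<subseteq> V" using in_V by blast
    obtain I where I: "good R A (V - {v, x, y, w, s, s', t, t'}) I" using delete[OF D] by blast
    have DI: "v \<notin> I" "w \<notin> I" "x \<notin> I" "y \<notin> I" "s \<notin> I" "s' \<notin> I" "t \<notin> I" "t' \<notin> I"
      using good_subset[OF I] by auto
    have cd: "c \<noteq> x" "d \<noteq> x" "d \<noteq> s" using c(2)[of x] d(2)[of x] d(2)[of s] nx ns nes' sym by metis+
    show False
    proof (cases "c \<in> I")
      case True
      show False
        by (rule no_attachment[OF I _ D, of "{x}" "[t', t, w, s, s', v, y]"])
          (use DI True in \<open>auto simp: check_simps nv nw nx ns ny nt c d cd nes' A in_V\<close>)
    next
      case False
      show False
        by (rule no_attachment[OF I _ D, of "{x, s}" "[s', t', t, w, v, y]"])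
          (use DI False in \<open>auto simp: check_simps nv nw nx ns ny nt c d cd nes' A in_V\<close>)
    qed
  qed
qed

subsection \<open>Discharging\<close>

text \<open>A vertex of degree 2 has charge -4. When one neighbour also has degree 2, the other one
  must pay all of it.\<close>

definition heavy :: "'a \<Rightarrow> bool" where
  "heavy x \<longleftrightarrow> two_vertex x \<and> (\<exists>x'. two_vertex x' \<and> R x x')"

text \<open>Two payments of 4 exceed the charge 33 - 26 = 7 by 1; the third neighbour has to make up
  for it.\<close>

definition bad :: "'a \<Rightarrow> bool" where
  "bad v \<longleftrightarrow> v \<in> V - A \<and> deg R V v = 3 \<and> (\<exists>x y. x \<noteq> y \<and> R v x \<and> R v y \<and> heavy x \<and> heavy y)"

text \<open>Ensures that the third neighbour of a bad vertex can pay. With the degenerate positions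
  excluded, the ten vertices are distinct and form a \<open>twin\<close>.\<close>

lemma no_adjacent_bad:
  assumes "bad v" "bad w" "R v w"
  shows False
proof -
  obtain x y x' y' where v: "v \<in> V - A" "deg R V v = 3"
    and x: "two_vertex x" "R v x" "two_vertex x'" "R x x'"
    and y: "x \<noteq> y" "two_vertex y" "R v y" "two_vertex y'" "R y y'"
    using assms(1) unfolding bad_def heavy_def by blast
  obtain s t s' t' where w: "w \<in> V - A" "deg R V w = 3"
    and s: "two_vertex s" "R w s" "two_vertex s'" "R s s'"
    and t: "s \<noteq> t" "two_vertex t" "R w t" "two_vertex t'" "R t t'"
    using assms(2) unfolding bad_def heavy_def by blast
  have "R w v" using assms(3) sym by blast
  note rule_shared = no_shared_thread[OF v w \<open>R v w\<close>]
  have 1: "\<not> R x s"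
    using rule_shared[OF x(1,2) _ s(1,2) y(2,3) y(1)[symmetric] y(4,5) t(2,3) t(1)[symmetric] t(4,5)] by blast
  have 2: "\<not> R x t"
    using rule_shared[OF x(1,2) _ t(2,3) y(2,3) y(1)[symmetric] y(4,5) s(1,2) t(1) s(3,4)] by blast
  have 3: "\<not> R y s"
    using rule_shared[OF y(2,3) _ s(1,2) x(1,2) y(1) x(3,4) t(2,3) t(1)[symmetric] t(4,5)] by blast
  have 4: "\<not> R y t"
    using rule_shared[OF y(2,3) _ t(2,3) x(1,2) y(1) x(3,4) s(1,2) t(1) s(3,4)] by blast
  have 5: "\<not> R x y"
    using no_triangle_twin[OF v w \<open>R v w\<close> x(1,2) y(2,3) _ s t(2,3,1,4,5)] by blast
  have 6: "\<not> R s t"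
    using no_triangle_twin[OF w v \<open>R w v\<close> s(1,2) t(2,3) _ x y(2,3,1,4,5)] by blast
  have deg3: "z \<noteq> v" "z \<noteq> w" if "two_vertex z" for z
    using that v w by (auto simp: two_vertex_def)
  note ne1 = deg3[OF x(1)] deg3[OF x(3)] deg3[OF y(2)] deg3[OF y(4)] deg3[OF s(1)] deg3[OF s(3)]
    deg3[OF t(2)] deg3[OF t(4)]
  have "v \<noteq> w" using \<open>R v w\<close> irrefl by blast
  have nv: "R v k \<longleftrightarrow> k = x \<or> k = y \<or> k = w" for k
    using three_vertexE[OF v(2) x(2) y(3,1)] \<open>R v w\<close> ne1 by metis
  have nw: "R w k \<longleftrightarrow> k = v \<or> k = s \<or> k = t" for k
    using three_vertexE[OF w(2) s(2) t(3,1)] \<open>R w v\<close> ne1 by metis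
  have thread: "R p k \<longleftrightarrow> k = u \<or> k = p'"
    if "two_vertex p" "R u p" "two_vertex p'" "R p p'" "u = v \<or> u = w" for p p' u k
  proof -
    have "u \<noteq> p'" using that(3,5) deg3 by blast
    then show ?thesis using two_vertexE[OF that(1,4)] sym[OF that(2)] by metis
  qed
  have nx: "R x k \<longleftrightarrow> k = v \<or> k = x'" for k using thread[OF x(1,2,3,4)] by blast
  have ny: "R y k \<longleftrightarrow> k = v \<or> k = y'" for k using thread[OF y(2-5)] by blast
  have ns: "R s k \<longleftrightarrow> k = w \<or> k = s'" for k using thread[OF s(1,2,3,4)] by blast
  have nt: "R t k \<longleftrightarrow> k = w \<or> k = t'" for k using thread[OF t(2-5)] by blast
  have inner: "p' \<noteq> q'" if "two_vertex p" "two_vertex p'" "two_vertex q" "R p p'" "R q q'" "p \<noteq> q" for p p' q q'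
    using no_three_two_vertices[OF that(1,2,3)] that(4-6) sym by blast
  \<comment> \<open>The far end is not of degree 2, since three such vertices never follow each
    other, and it is neither \<open>v\<close> nor \<open>w\<close>; all other listed vertices have
    degree 2.\<close>
  have outer: "\<exists>a. (\<forall>k. R p' k \<longleftrightarrow> k = p \<or> k = a) \<and> a \<in> V - {v, w, x, x', y, y', s, s', t, t'}"
    if "two_vertex p" "two_vertex p'" "R p p'" "\<not> R p' v" "\<not> R p' w" for p p'
  proof -
    note two = two_vertexE[OF that(2) sym[OF that(3)]]
    obtain a where a: "a \<noteq> p" "\<And>k. R p' k \<longleftrightarrow> k = p \<or> k = a"
      using two by blast
    have "\<not> two_vertex a"
      using no_three_two_vertices[OF that(1,2), of a] a by blast
    moreover have "a \<noteq> v" "a \<noteq> w" using a that by auto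
    ultimately have "a \<in> V - {v, w, x, x', y, y', s, s', t, t'}"
      using x y s t a(2)[of a] edge_in_V'[of p' a] a(2) by blast
    then show ?thesis using a by blast
  qed
  have xs: "x \<noteq> s" "x \<noteq> t" "y \<noteq> s" "y \<noteq> t"
    using nx[of v] ny[of v] ns[of v] nt[of v] ne1 \<open>v \<noteq> w\<close> by blast+
  have ne2: "x' \<noteq> x" "y' \<noteq> y" "s' \<noteq> s" "t' \<noteq> t"
    using x y s t irrefl by blast+
  have cross: "x' \<noteq> y" "x' \<noteq> s" "x' \<noteq> t" "y' \<noteq> x" "y' \<noteq> s" "y' \<noteq> t" "s' \<noteq> x" "s' \<noteq> y" "s' \<noteq> t"
    "t' \<noteq> x" "t' \<noteq> y" "t' \<noteq> s"
    using 1 2 3 4 5 6 x(4) y(5) s(4) t(5) sym by blast+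
  have far: "x' \<noteq> y'" "x' \<noteq> s'" "x' \<noteq> t'" "y' \<noteq> s'" "y' \<noteq> t'" "s' \<noteq> t'"
    using inner x y s t xs by blast+
  have dist: "distinct [v, w, x, x', y, y', s, s', t, t']"
    using ne1 \<open>v \<noteq> w\<close> xs ne2 cross far y(1) t(1) by simp
  have not_vw: "\<not> R x' v" "\<not> R x' w" "\<not> R y' v" "\<not> R y' w" "\<not> R s' v" "\<not> R s' w" "\<not> R t' v" "\<not> R t' w"
    using nv nw sym ne1 ne2 cross by blast+
  obtain a where a: "\<forall>k. R x' k \<longleftrightarrow> k = x \<or> k = a" "a \<in> V - {v, w, x, x', y, y', s, s', t, t'}"
    using outer[OF x(1,3,4)] not_vw by blast
  obtain b where b: "\<forall>k. R y' k \<longleftrightarrow> k = y \<or> k = b" "b \<in> V - {v, w, x, x', y, y', s, s', t, t'}"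
    using outer[OF y(2,4,5)] not_vw by blast
  obtain c where c: "\<forall>k. R s' k \<longleftrightarrow> k = s \<or> k = c" "c \<in> V - {v, w, x, x', y, y', s, s', t, t'}"
    using outer[OF s(1,3,4)] not_vw by blast
  obtain d where d: "\<forall>k. R t' k \<longleftrightarrow> k = t \<or> k = d" "d \<in> V - {v, w, x, x', y, y', s, s', t, t'}"
    using outer[OF t(2,4,5)] not_vw by blast
  have sub: "{v, w, x, x', y, y', s, s', t, t'} \<subseteq> V - A"
    using v w x y s t unfolding two_vertex_def by blast
  have sub': "{a, b, c, d} \<subseteq> V - {v, w, x, x', y, y', s, s', t, t'}"
    using a(2) b(2) c(2) d(2) by blast
  have "twin v x x' a y y' b w s s' c t t' d"
    unfolding twin_def by (intro conjI allI nv nw nx ny ns nt a(1)[rule_format] b(1)[rule_format]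
      c(1)[rule_format] d(1)[rule_format] dist sub sub')
  then show False using no_twin by blast
qed

definition charge :: "'a \<Rightarrow> int" where
  "charge u = 11 * int (deg R V u) - (if u \<in> A then 10 else 26)"

definition give :: "'a \<Rightarrow> 'a \<Rightarrow> int" where
  "give u k =
     (if two_vertex u then 0
      else if heavy k then 4
      else if two_vertex k then 2
      else if bad k \<and> \<not> bad u then 1 else 0)"

lemma sum_charge: "(\<Sum>u\<in>V. charge u) = - 2 * potential R A V"
proof -
  have "(\<Sum>u\<in>V. charge u) = 11 * int (\<Sum>u\<in>V. deg R V u) - (\<Sum>u\<in>V. if u \<in> A then 10 else 26)"
    by (simp add: charge_def sum_subtractf sum_distrib_left)
  moreover have "(\<Sum>u\<in>V. if u \<in> A then 10 else 26 :: int) = 10 * int (card (V \<inter> A)) + 26 * int (card (V - A))"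
    by (subst sum.If_cases) (auto simp: Diff_eq)
  ultimately show ?thesis by (simp add: sum_deg potential_def)
qed

lemma give_cancel: "(\<Sum>u\<in>V. \<Sum>k\<in>nbh R V u. give u k) = (\<Sum>u\<in>V. \<Sum>k\<in>nbh R V u. give k u)"
proof -
  have "(\<Sum>u\<in>V. \<Sum>k\<in>nbh R V u. give u k) = (\<Sum>u\<in>V. \<Sum>k\<in>{k \<in> V. R u k}. give u k)"
    by (simp add: nbh_def)
  also have "\<dots> = (\<Sum>k\<in>V. \<Sum>u\<in>{u \<in> V. R u k}. give u k)"
    by (rule sum.swap_restrict) simp_all
  also have "\<dots> = (\<Sum>k\<in>V. \<Sum>u\<in>nbh R V k. give u k)"
    by (simp add: nbh_def sym_iff)
  finally show ?thesis .
qed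

lemma give_nonneg: "give u k \<ge> 0"
  by (simp add: give_def)

lemma give_le_4: "give u k \<le> 4"
  by (simp add: give_def)

lemma give_le_4_deg: "(\<Sum>k\<in>nbh R V u. give u k) \<le> 4 * int (deg R V u)"
  using sum_bounded_above[of "nbh R V u" "give u" 4] give_le_4 by (simp add: deg_def)

text \<open>No edge carries more than 4 away from \<open>u\<close>, which 11 d - 26 covers for d at
  least 4 and 11 d - 10 for d at least 2. Ordinary vertices of degree 2 and 3 and precoloured ones
  of degree 1 need the reducible configurations.\<close>

lemma final_charge:
  assumes "u \<in> V"
  shows "charge u - (\<Sum>k\<in>nbh R V u. give u k) + (\<Sum>k\<in>nbh R V u. give k u) \<ge> 0"
proof -
  have received: "(\<Sum>k\<in>nbh R V u. give k u) \<ge> 0"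
    by (intro sum_nonneg give_nonneg)
  show ?thesis
  proof (cases "u \<in> A")
    case True
    show ?thesis
    proof (cases "deg R V u = 1")
      case True
      then obtain p where p: "nbh R V u = {p}"
        by (auto simp: deg_def card_1_singleton_iff)
      then have "R p u" using sym by (auto simp: nbh_def)
      then have "\<not> two_vertex p"
        using leaf_not_adjacent_two_vertex[of p u] \<open>u \<in> A\<close> True by auto
      then have "give u p \<le> 1" by (simp add: give_def heavy_def)
      then show ?thesis using p received True \<open>u \<in> A\<close> by (simp add: charge_def)
    next
      case False
      then have "deg R V u \<ge> 2" using deg_ge_1[OF assms] by simp
      then show ?thesis using give_le_4_deg[of u] received True by (simp add: charge_def)
    qed
  next
    case False
    then have u: "u \<in> V - A" using assms by blast
    then have "deg R V u \<ge> 2" by (rule deg_ge_2)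
    then consider "deg R V u = 2" | "deg R V u = 3" | "deg R V u \<ge> 4" by linarith
    then show ?thesis
    proof cases
      case 1
      then have two: "two_vertex u" using u by (simp add: two_vertex_def)
      obtain p q where pq: "p \<noteq> q" "nbh R V u = {p, q}" using 1 by (auto simp: deg_def card_2_iff)
      then have R: "R u p" "R u q" by (auto simp: nbh_def)
      have "give p u + give q u \<ge> 4"
      proof (cases "two_vertex p \<or> two_vertex q")
        case True
        then have "heavy u" using two R by (auto simp: heavy_def)
        moreover have "\<not> (two_vertex p \<and> two_vertex q)"
          using no_three_two_vertices[OF _ two _ R(1,2)] pq(1) by blast
        ultimately have "give p u = 4 \<or> give q u = 4" using two by (auto simp: give_def)
        then show ?thesis using give_nonneg[of p u] give_nonneg[of q u] by linarith
      next
        case False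
        then have "give p u \<ge> 2" "give q u \<ge> 2" using two by (auto simp: give_def)
        then show ?thesis by linarith
      qed
      moreover have "(\<Sum>k\<in>nbh R V u. give u k) = 0" using two by (simp add: give_def)
      ultimately show ?thesis using pq 1 False by (simp add: charge_def)
    next
      case 2
      then have not_two: "\<not> two_vertex u" by (simp add: two_vertex_def)
      obtain p q r where pqr: "nbh R V u = {p, q, r}" "p \<noteq> q" "q \<noteq> r" "p \<noteq> r"
        using 2 by (auto simp: deg_def card_3_iff)
      then have R: "R u p" "R u q" "R u r" by (auto simp: nbh_def)
      have sum3: "(\<Sum>k\<in>nbh R V u. f k) = f p + f q + f r" for f :: "'a \<Rightarrow> int"
        using pqr by simp
      have three: "\<not> (heavy x \<and> two_vertex y \<and> two_vertex z)"
        if "{x, y, z} = {p, q, r}" "x \<noteq> y" "x \<noteq> z" "y \<noteq> z" for x y z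
      proof -
        have "x \<in> {p, q, r}" "y \<in> {p, q, r}" "z \<in> {p, q, r}"
          unfolding that(1)[symmetric] by simp_all
        then have "R u x" "R u y" "R u z" using R by auto
        then show ?thesis
          using no_three_two_neighbours[OF u 2, of x y z] that by (auto simp: heavy_def)
      qed
      have th: "\<not> (heavy p \<and> two_vertex q \<and> two_vertex r)" "\<not> (heavy q \<and> two_vertex p \<and> two_vertex r)"
        "\<not> (heavy r \<and> two_vertex p \<and> two_vertex q)"
        using three[of p q r] three[of q p r] three[of r p q] pqr by auto
      have ht: "two_vertex k" if "heavy k" for k using that by (simp add: heavy_def)
      show ?thesis
      proof (cases "bad u")
        case True
        then obtain x y where xy: "x \<noteq> y" "R u x" "R u y" "heavy x" "heavy y"
          by (auto simp: bad_def)
        obtain z where z: "z \<noteq> x" "z \<noteq> y" "\<And>k. R u k \<longleftrightarrow> k = x \<or> k = y \<or> k = z"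
          using three_vertexE[OF 2 xy(2,3,1)] by blast
        have nbh: "nbh R V u = {x, y, z}" using z(3) by (auto simp: nbh_V)
        then have sum: "(\<Sum>k\<in>nbh R V u. f k) = f x + f y + f z" for f :: "'a \<Rightarrow> int"
          using xy(1) z(1,2) by simp
        have "\<not> two_vertex z"
          using three[OF nbh[unfolded pqr(1), symmetric] xy(1) z(1,2)[symmetric]] xy(4) ht[OF xy(5)]
          by blast
        moreover have "\<not> bad z" using no_adjacent_bad[OF True] z(3) by blast
        moreover have "\<not> heavy u" "\<not> heavy z" using not_two \<open>\<not> two_vertex z\<close> ht by blast+
        \<comment> \<open>The balance of a bad vertex is 7 - 4 - 4 + 1 = 0.\<close>
        ultimately have "give z u = 1" "give u z = 0" "give u x = 4" "give u y = 4"
          by (simp_all add: give_def True not_two xy(4,5))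
        moreover have "give x u \<ge> 0" "give y u \<ge> 0" by (rule give_nonneg)+
        ultimately show ?thesis unfolding sum using 2 False by (simp add: charge_def)
      next
        case not_bad: False
        then have one: "\<not> (heavy p \<and> heavy q)" "\<not> (heavy p \<and> heavy r)" "\<not> (heavy q \<and> heavy r)"
          using u 2 R pqr unfolding bad_def by blast+
        have "give u k \<le> (if heavy k then 4 else if two_vertex k then 2 else 1)" for k
          by (simp add: give_def)
        then have "give u p + give u q + give u r \<le> (if heavy p then 4 else if two_vertex p then 2 else 1)
          + (if heavy q then 4 else if two_vertex q then 2 else 1) + (if heavy r then 4 else if two_vertex r then 2 else 1)"
          by (intro add_mono)
        \<comment> \<open>At most one neighbour is heavy, and then at most one other has degree 2:
          the extremes are 4 + 2 + 1 and 2 + 2 + 2.\<close>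
        also have "\<dots> \<le> 7"
          using th one by auto
        finally show ?thesis using received sum3[of "give u"] 2 False by (simp add: charge_def)
      qed
    next
      case 3
      then show ?thesis using give_le_4_deg[of u] received False by (simp add: charge_def)
    qed
  qed
qed

theorem contradiction: False
proof -
  have "(\<Sum>u\<in>V. charge u) = (\<Sum>u\<in>V. charge u - (\<Sum>k\<in>nbh R V u. give u k) + (\<Sum>k\<in>nbh R V u. give k u))"
    by (simp add: sum.distrib sum_subtractf give_cancel)
  also have "\<dots> \<ge> 0" by (intro sum_nonneg final_charge)
  finally have "potential R A V \<le> 0" by (simp add: sum_charge)
  then have "V = {}" using potential_ge_1[of V] by force
  then have "good R A V {}" by (simp add: good_def acyclic_on_def)
  then show False using not_good by blast
qed

end

section \<open>Induction on the number of vertices\<close>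

theorem sparse_imp_good:
  fixes R :: "'a \<Rightarrow> 'a \<Rightarrow> bool"
  assumes "finite V" "sgraph R" "sparse R A V"
  shows "\<exists>I. good R A V I"
  using assms
proof (induction "card V" arbitrary: R A V rule: less_induct)
  case less
  show ?case
  proof (rule ccontr)
    assume none: "\<nexists>I. good R A V I"
    \<comment> \<open>The locale wants all edges inside \<open>V\<close>. Restricting
      \<open>R\<close> changes neither potentials of subsets of \<open>V\<close> nor the good
      sets.\<close>
    define R' where "R' u v \<longleftrightarrow> u \<in> V \<and> v \<in> V \<and> R u v" for u v
    interpret sgraph R by fact
    have "sgraph R'" by unfold_locales (auto simp: R'_def sym)
    moreover have "sparse R' A V"
      unfolding sparse_def
    proof (intro allI impI)
      fix S assume S: "S \<subseteq> V" "S \<noteq> {}"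
      have "potential R' A S = potential R A S"
        using S by (intro potential_cong) (auto simp: R'_def)
      then show "potential R' A S \<ge> 1" using S less.prems(3) by (auto simp: sparse_def)
    qed
    moreover have "\<not> good R' A V I" for I
    proof
      assume I: "good R' A V I"
      have "few R W w" if "W \<subseteq> V" "w \<in> W" "few R' W w" for W w
        using that unfolding few_def R'_def by blast
      moreover have "acyclic_on R' (V - I)" using I by (simp add: good_def)
      ultimately have "acyclic_on R (V - I)"
        unfolding acyclic_on_def by (meson Diff_subset subset_trans)
      moreover have "I \<subseteq> V - A" using I by (simp add: good_def)
      moreover have "R' k i" if "k \<in> V" "i \<in> I" "R k i" for k i
        using that \<open>I \<subseteq> V - A\<close> by (auto simp: R'_def)
      ultimately have "good R A V I"
        using I unfolding good_def by blast
      then show False using none by blast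
    qed
    ultimately interpret minimal_counterexample R' A V
      using less.hyps less.prems(1)
      by (intro minimal_counterexample.intro minimal_counterexample_axioms.intro) (auto simp: R'_def)
    show False by (rule contradiction)
  qed
qed

subsection \<open>Graphs of bounded maximum average degree\<close>

lemma (in wf_digraph) awalk_verts_conv_head:
  "cas u p v \<Longrightarrow> awalk_verts u p = u # map (head G) p"
  by (induction p arbitrary: u) auto

context graph
begin

lemma sgraph_dominates: "sgraph (\<lambda>u v. u \<rightarrow> v)"
  using sym_arcs by unfold_locales (auto simp: symmetric_def sym_def arcs_ends_conv dest: no_loops)

lemma dominates_induce_subgraph_iff: "u \<rightarrow>\<^bsub>G \<restriction> S\<^esub> v \<longleftrightarrow> u \<in> S \<and> v \<in> S \<and> u \<rightarrow> v"
  by (auto simp: arcs_ends_conv)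

lemma graph_induce_subgraph:
  assumes "S \<subseteq> verts G"
  shows "graph (G \<restriction> S)"
proof -
  interpret H: wf_digraph "G \<restriction> S" by unfold_locales auto
  have "symmetric (G \<restriction> S)"
    unfolding symmetric_def sym_def dominates_induce_subgraph_iff
    using arcs_ends_symmetric[OF sym_arcs] by blast
  then show ?thesis
    using finite_subset[OF assms finite_verts]
    by unfold_locales (auto simp: arc_to_ends_def dest: no_loops no_multi_arcs)
qed

lemma edges_induce_subgraph: "edges (G \<restriction> S) = edges_in (\<lambda>u v. u \<rightarrow> v) S"
  by (auto simp: edges_def edges_in_def dominates_induce_subgraph_iff)

lemma card_edges_le_mad:
  assumes "S \<subseteq> verts G" "S \<noteq> {}"
  shows "2 * real (card (edges_in (\<lambda>u v. u \<rightarrow> v) S)) / real (card S) \<le> mad G"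
proof -
  let ?f = "\<lambda>H. 2 * real (card (edges H)) / real (card (verts H))"
  have "finite {?f H | H. graph H \<and> subgraph H G \<and> verts H \<noteq> {}}"
    by (rule finite_subset[OF _ finite_imageI[OF finite_subgraphs, of ?f]]) auto
  moreover have "subgraph (G \<restriction> S) G"
    using assms(1) graph_induce_subgraph[OF assms(1)] wf_digraph_axioms
    by (auto simp: subgraph_def compatible_def graph_def digraph_def fin_digraph_def)
  then have "?f (G \<restriction> S) \<in> {?f H | H. graph H \<and> subgraph H G \<and> verts H \<noteq> {}}"
    using assms graph_induce_subgraph[OF assms(1)] by (intro CollectI exI[of _ "G \<restriction> S"]) auto
  ultimately have "?f (G \<restriction> S) \<le> mad G"
    unfolding mad_def by (rule Max_ge)
  then show ?thesis by (simp add: edges_induce_subgraph)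
qed

text \<open>Clearing denominators gives 11 m < 13 n; as the potential is an integer, positive means
  at least 1.\<close>

lemma sparse_mad:
  assumes "mad G < 26 / 11"
  shows "sparse (\<lambda>u v. u \<rightarrow> v) {} (verts G)"
  unfolding sparse_def
proof (intro allI impI)
  fix S assume S: "S \<subseteq> verts G" "S \<noteq> {}"
  have "card S > 0" using S finite_subset[OF S(1)] by (simp add: card_gt_0_iff)
  moreover have "2 * real (card (edges_in (\<lambda>u v. u \<rightarrow> v) S)) / real (card S) < 26 / 11"
    using card_edges_le_mad[OF S] assms by linarith
  ultimately have "11 * real (card (edges_in (\<lambda>u v. u \<rightarrow> v) S)) < 13 * real (card S)"
    by (simp add: field_simps)
  then have "11 * card (edges_in (\<lambda>u v. u \<rightarrow> v) S) < 13 * card S" by linarith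
  then show "1 \<le> potential (\<lambda>u v. u \<rightarrow> v) {} S" by (simp add: potential_def)
qed

text \<open>Each vertex of a cycle of length at least 3 has two different neighbours on it, so the
  vertex set of the cycle has no leaf.\<close>

lemma undirected_forest_acyclic_on:
  assumes "acyclic_on (\<lambda>u v. u \<rightarrow> v) F" "F \<subseteq> verts G"
  shows "undirected_forest (G \<restriction> F)"
  unfolding undirected_forest_def
proof (intro notI, elim exE conjE)
  fix p assume cyc: "pre_digraph.cycle (G \<restriction> F) p" and len: "3 \<le> length p"
  interpret H: graph "G \<restriction> F" using graph_induce_subgraph assms(2) .
  obtain u where u: "H.awalk u p u" "distinct (tl (H.awalk_verts u p))"
    using cyc unfolding H.cycle_def by blast
  define n where "n = length p"
  define h where "h i = head G (p ! i)" for i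
  have cas: "H.cas u p u" and arcs: "set p \<subseteq> arcs (G \<restriction> F)" using u by (auto simp: H.awalk_def)
  have verts: "H.awalk_verts u p = u # map (head G) p"
    using H.awalk_verts_conv_head[OF cas] by simp
  have "distinct (map (head G) p)" using u(2) verts by simp
  then have inj: "i = j" if "h i = h j" "i < n" "j < n" for i j
    using that by (simp add: h_def n_def distinct_conv_nth) metis
  have "p \<noteq> []" using len by auto
  have "last (H.awalk_verts u p) = u" using H.awlast_if_cas[OF cas] .
  then have u_h: "u = h (n - 1)"
    using verts \<open>p \<noteq> []\<close> by (simp add: h_def n_def last_map last_conv_nth)
  \<comment> \<open>Arc \<open>i\<close> runs from \<open>h (pr i)\<close> to \<open>h i\<close>.
    The index wraps around because the walk starts at \<open>u\<close>, the head of its last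
    arc.\<close>
  define pr where "pr i = (if i = 0 then n - 1 else i - 1)" for i
  have tail_h: "tail G (p ! i) = h (pr i)" if "i < n" for i
  proof -
    have "tail G (p ! i) = H.awalk_verts u p ! i"
      using that \<open>p \<noteq> []\<close> H.awalk_verts_conv[of u p] by (simp add: nth_append n_def)
    then show ?thesis
      using verts that u_h by (cases i) (simp_all add: pr_def h_def n_def)
  qed
  have arc: "h (pr i) \<rightarrow> h i" "h i \<in> F" if "i < n" for i
  proof -
    have "p ! i \<in> arcs (G \<restriction> F)" using nth_mem[of i p] that arcs unfolding n_def by blast
    then show "h (pr i) \<rightarrow> h i" "h i \<in> F"
      using tail_h[OF that] dominatesI[of "p ! i"] by (auto simp: arc_to_ends_def h_def)
  qed
  have "n \<ge> 3" using len by (simp add: n_def)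
  then have "h ` {..<n} \<noteq> {}" "h ` {..<n} \<subseteq> F" using arc by (auto simp: lessThan_empty_iff)
  then obtain i where i: "i < n" "few (\<lambda>u v. u \<rightarrow> v) (h ` {..<n}) (h i)"
    using assms(1) unfolding acyclic_on_def by blast
  \<comment> \<open>The cyclic successor of \<open>i\<close>. For \<open>n = 2\<close> it would
    coincide with \<open>pr i\<close>; this is where length at least 3 enters.\<close>
  define j where "j = (if Suc i = n then 0 else Suc i)"
  have j: "j < n" "pr j = i" "pr i < n" "pr i \<noteq> j"
    using i \<open>n \<ge> 3\<close> by (auto simp: j_def pr_def)
  have "h i \<rightarrow> h (pr i)"
    using arc(1)[OF i(1)] sgraph.sym[OF sgraph_dominates] by blast
  moreover have "h i \<rightarrow> h j" using arc(1)[OF j(1)] j(2) by simp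
  ultimately have "h (pr i) = h j"
    using fewD[OF i(2)] j by blast
  then show False using inj j by blast
qed

text \<open>The distance is an infimum over walks, infinite if there are none, so it suffices that
  every walk has at least 3 arcs.\<close>

lemma graph_dist_gt_2:
  assumes "x \<noteq> y" "\<not> x \<rightarrow> y" "\<And>z. x \<rightarrow> z \<Longrightarrow> \<not> z \<rightarrow> y"
  shows "graph_dist G x y > 2"
proof -
  have "length p \<ge> 3" if "awalk x p y" for p
  proof (rule ccontr)
    assume "\<not> ?thesis"
    then consider "p = []" | e where "p = [e]" | e f where "p = [e, f]"
      by (cases p; cases "tl p"; cases "tl (tl p)") auto
    then show False
    proof cases
      case 1
      then show ?thesis using that assms by (auto simp: awalk_def)
    next
      case 2
      then have "x \<rightarrow> y" using that by (auto simp: awalk_def arcs_ends_conv)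
      then show ?thesis using assms by blast
    next
      case 3
      then have "x \<rightarrow> head G e" "head G e \<rightarrow> y"
        using that dominatesI[of e] dominatesI[of f] by (auto simp: awalk_def arc_to_ends_def)
      then show ?thesis using assms by blast
    qed
  qed
  moreover have "awalk_cost (\<lambda>_. 1) p = real (length p)" for p
    by (induction p) auto
  ultimately have "(3 :: ereal) \<le> \<mu> (\<lambda>_. 1) x y"
    unfolding \<mu>_def by (intro INF_greatest) (simp add: numeral_eq_ereal)
  then show ?thesis unfolding graph_dist_def by (rule less_le_trans[rotated]) simp
qed

end

theorem lemma6:
  fixes G :: "('a, 'b) pre_digraph"
  assumes "graph G"
    and "mad G < 26 / 11"
  shows "\<exists>I F. I \<union> F = verts G \<and> I \<inter> F = {} \<and>
    undirected_forest (G \<restriction> F) \<and> two_independent G I"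
proof -
  interpret graph G by fact
  interpret R: sgraph "\<lambda>u v. u \<rightarrow>\<^bsub>G\<^esub> v" by (rule sgraph_dominates)
  obtain I where I: "good (\<lambda>u v. u \<rightarrow>\<^bsub>G\<^esub> v) {} (verts G) I"
    using sparse_imp_good[OF finite_verts R.sgraph_axioms sparse_mad[OF assms(2)]] by blast
  have sub: "I \<subseteq> verts G" using I by (auto simp: good_def)
  \<comment> \<open>Distance 1 would be an edge inside \<open>I\<close>, and distance 2 a vertex
    with two neighbours in \<open>I\<close>; \<open>good\<close> forbids both.\<close>
  have I': "k \<notin> I" "j \<in> I \<Longrightarrow> k \<rightarrow>\<^bsub>G\<^esub> j \<Longrightarrow> j = i" if "i \<in> I" "k \<rightarrow>\<^bsub>G\<^esub> i" for k i j
    using I that adj_in_verts(1)[OF that(2)] unfolding good_def by blast+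
  have "two_independent G I"
    unfolding two_independent_def using sub I' R.sym by (intro conjI ballI impI graph_dist_gt_2) blast+
  moreover have "undirected_forest (G \<restriction> (verts G - I))"
    using I by (intro undirected_forest_acyclic_on) (auto simp: good_def)
  ultimately show ?thesis
    using sub by (intro exI[of _ I] exI[of _ "verts G - I"]) auto
qed

end
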